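(* There is an algorithm which takes as input an arbitrary finite group presentation $\langle x_1,\ldots,x_n\mid r_1,\ldots,r_m\rangle$ and which is guaranteed to terminate with the answer "yes" if and only if the group $G$ defined by that presentation is large (if $G$ is not large, the algorithm might not terminate).
   Context: A finitely generated group $G$ is large if it has a finite index subgroup possessing a surjective homomorphism onto a non-abelian free group. *)

theory Defs
  imports "HOL-Algebra.Generated_Groups" "HOL-Library.Nat_Bijection"
begin

section \<open>Partial recursive functions\<close>

text \<open>
  Kleene's partial recursive functions, given by codes with a big-step semantics:
  \<open>evaluates f xs y\<close> says that the computation of \<open>f\<close> on the arguments \<open>xs\<close> terminates
  with result \<open>y\<close>.  Arities are not tracked: a code that lacks an argument it needs
  simply has no result, and superfluous arguments are ignored by the basic functions.
\<close>

datatype recf =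
    Zero
  | Succ
  | Proj nat
  | Comp recf "recf list"
  | Prec recf recf
  | Mu recf

inductive evaluates :: "recf \<Rightarrow> nat list \<Rightarrow> nat \<Rightarrow> bool" where
  Zero: "evaluates Zero xs 0"
| Succ: "evaluates Succ (x # xs) (Suc x)"
| Proj: "i < length xs \<Longrightarrow> evaluates (Proj i) xs (xs ! i)"
| Comp: "list_all2 (\<lambda>g y. evaluates g xs y) gs ys \<Longrightarrow> evaluates f ys z
         \<Longrightarrow> evaluates (Comp f gs) xs z"
| Prec_0: "evaluates f xs y \<Longrightarrow> evaluates (Prec f g) (0 # xs) y"
| Prec_Suc: "evaluates (Prec f g) (k # xs) r \<Longrightarrow> evaluates g (k # r # xs) y
         \<Longrightarrow> evaluates (Prec f g) (Suc k # xs) y"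
| Mu: "evaluates f (k # xs) 0 \<Longrightarrow> (\<And>j. j < k \<Longrightarrow> \<exists>y. evaluates f (j # xs) (Suc y))
         \<Longrightarrow> evaluates (Mu f) xs k"

inductive_cases evaluates_ZeroE: "evaluates Zero xs y"
inductive_cases evaluates_SuccE: "evaluates Succ xs y"
inductive_cases evaluates_ProjE: "evaluates (Proj i) xs y"
inductive_cases evaluates_CompE: "evaluates (Comp f gs) xs y"
inductive_cases evaluates_Prec_0E: "evaluates (Prec f g) (0 # xs) y"
inductive_cases evaluates_Prec_SucE: "evaluates (Prec f g) (Suc k # xs) y"
inductive_cases evaluates_MuE: "evaluates (Mu f) xs y"

lemma evaluates_unique: "evaluates f xs y \<Longrightarrow> evaluates f xs y' \<Longrightarrow> y = y'"
proof (induction f xs y arbitrary: y' rule: evaluates.induct)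
  case (Zero xs)
  then show ?case by (rule evaluates_ZeroE) simp
next
  case (Succ x xs)
  then show ?case by (rule evaluates_SuccE) simp
next
  case (Proj i xs)
  from Proj(2) show ?case by (rule evaluates_ProjE) simp
next
  case (Comp xs gs ys f z)
  from Comp.prems obtain ys' where *: "list_all2 (\<lambda>g y. evaluates g xs y) gs ys'" "evaluates f ys' y'"
    by (rule evaluates_CompE)
  have "ys = ys'"
    using Comp.IH(1) *(1)
    by (auto simp: list_all2_conv_all_nth intro!: nth_equalityI)
  with *(2) Comp.IH(2) show ?case by blast
next
  case (Prec_0 f xs y g)
  from Prec_0.prems have "evaluates f xs y'" by (rule evaluates_Prec_0E)
  then show ?case by (rule Prec_0.IH)
next
  case (Prec_Suc f g k xs r y)
  from Prec_Suc.prems obtain r' where "evaluates (Prec f g) (k # xs) r'" "evaluates g (k # r' # xs) y'"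
    by (rule evaluates_Prec_SucE)
  with Prec_Suc.IH show ?case by metis
next
  case (Mu f k xs)
  from Mu.prems have *: "evaluates f (y' # xs) 0"
      "\<And>j. j < y' \<Longrightarrow> \<exists>y. evaluates f (j # xs) (Suc y)"
    by (auto elim: evaluates_MuE)
  have "\<not> k < y'" using Mu.IH(1) *(2) by fastforce
  moreover have "\<not> y' < k" using Mu.IH(2) *(1) by fastforce
  ultimately show ?case by simp
qed


text \<open>An algorithm on a single number gives the answer ``yes'' by terminating with result \<open>1\<close>.\<close>

definition answers_yes :: "recf \<Rightarrow> nat \<Rightarrow> bool" where
  "answers_yes A x \<longleftrightarrow> evaluates A [x] 1"


section \<open>Free groups and presentations\<close>

text \<open>The letter \<open>(x, True)\<close> is the generator \<open>x\<close>, and \<open>(x, False)\<close> is its formal inverse.\<close>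

type_synonym 'a letter = "'a \<times> bool"
type_synonym 'a word = "'a letter list"

fun inv_letter :: "'a letter \<Rightarrow> 'a letter" where
  "inv_letter (x, b) = (x, \<not> b)"

fun reduced :: "'a word \<Rightarrow> bool" where
  "reduced (a # b # w) \<longleftrightarrow> b \<noteq> inv_letter a \<and> reduced (b # w)"
| "reduced _ \<longleftrightarrow> True"

fun push_letter :: "'a letter \<Rightarrow> 'a word \<Rightarrow> 'a word" where
  "push_letter a [] = [a]"
| "push_letter a (b # w) = (if b = inv_letter a then w else a # b # w)"

definition free_reduce :: "'a word \<Rightarrow> 'a word" where
  "free_reduce w = foldr push_letter w []"

definition words_over :: "'a set \<Rightarrow> 'a word set" where
  "words_over S = {w. fst ` set w \<subseteq> S}"

definition free_group :: "'a set \<Rightarrow> 'a word monoid" where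
  "free_group S =
     \<lparr>carrier = {w \<in> words_over S. reduced w}, mult = (\<lambda>u v. free_reduce (u @ v)), one = []\<rparr>"

definition normal_closure :: "('a, 'b) monoid_scheme \<Rightarrow> 'a set \<Rightarrow> 'a set" where
  "normal_closure G R = \<Inter>{N. N \<lhd> G \<and> R \<subseteq> N}"

text \<open>
  The presentation with generators \<open>x\<^sub>0, \<dots>, x\<^sub>n\<^sub>-\<^sub>1\<close> and relators \<open>rs\<close> is
  represented by \<open>n\<close> and \<open>rs\<close>; relators need not be reduced words.
\<close>

definition is_presentation :: "nat \<Rightarrow> nat word list \<Rightarrow> bool" where
  "is_presentation n rs \<longleftrightarrow> set rs \<subseteq> words_over {..<n}"

definition presented_group :: "nat \<Rightarrow> nat word list \<Rightarrow> nat word set monoid" where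
  "presented_group n rs =
     free_group {..<n} Mod normal_closure (free_group {..<n}) (free_reduce ` set rs)"

definition encode_word :: "nat word \<Rightarrow> nat" where
  "encode_word w = list_encode (map (\<lambda>(i, b). prod_encode (i, of_bool b)) w)"

definition encode_presentation :: "nat \<Rightarrow> nat word list \<Rightarrow> nat" where
  "encode_presentation n rs = prod_encode (n, list_encode (map encode_word rs))"

lemma inv_letter_inv_letter [simp]: "inv_letter (inv_letter a) = a"
  by (cases a) simp

lemma reduced_Cons_Cons: "reduced (a # w) \<Longrightarrow> reduced w"
  by (cases w) auto

lemma reduced_push_letter: "reduced w \<Longrightarrow> reduced (push_letter a w)"
  by (cases w) (auto dest: reduced_Cons_Cons)

lemma reduced_foldr_push_letter: "reduced v \<Longrightarrow> reduced (foldr push_letter u v)"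
  by (induction u) (auto simp: reduced_push_letter)

lemma reduced_free_reduce: "reduced (free_reduce w)"
  by (simp add: free_reduce_def reduced_foldr_push_letter)

lemma free_reduce_reduced: "reduced w \<Longrightarrow> free_reduce w = w"
  unfolding free_reduce_def by (induction w rule: reduced.induct) auto

lemma set_push_letter: "set (push_letter a w) \<subseteq> insert a (set w)"
  by (cases w) auto

lemma set_free_reduce: "set (free_reduce w) \<subseteq> set w"
  unfolding free_reduce_def using set_push_letter by (induction w) fastforce+

lemma push_letter_inv_letter: "reduced w \<Longrightarrow> push_letter a (push_letter (inv_letter a) w) = w"
  by (cases w rule: reduced.cases) auto

lemma foldr_push_letter_push_letter:
  "reduced u \<Longrightarrow> reduced v \<Longrightarrow>
     foldr push_letter (push_letter a u) v = push_letter a (foldr push_letter u v)"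
  by (cases u) (auto simp: push_letter_inv_letter reduced_foldr_push_letter)

lemma foldr_push_letter_free_reduce:
  "reduced v \<Longrightarrow> foldr push_letter (free_reduce u) v = foldr push_letter u v"
proof (induction u)
  case (Cons a u)
  have "free_reduce (a # u) = push_letter a (free_reduce u)" by (simp add: free_reduce_def)
  with Cons show ?case by (simp add: foldr_push_letter_push_letter reduced_free_reduce)
qed (simp add: free_reduce_def)

lemma free_reduce_append: "free_reduce (u @ v) = foldr push_letter u (free_reduce v)"
  by (simp add: free_reduce_def)

lemma free_reduce_left: "free_reduce (free_reduce u @ v) = free_reduce (u @ v)"
  by (simp add: free_reduce_append foldr_push_letter_free_reduce reduced_free_reduce)

lemma free_reduce_right: "free_reduce (u @ free_reduce v) = free_reduce (u @ v)"
  by (simp add: free_reduce_append free_reduce_reduced reduced_free_reduce)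

lemma free_reduce_inverse: "free_reduce (map inv_letter (rev w) @ w) = []"
proof (induction w)
  case (Cons a w)
  have "push_letter (inv_letter a) (push_letter a (free_reduce w)) = free_reduce w"
    using push_letter_inv_letter[of "free_reduce w" "inv_letter a"]
    by (simp add: reduced_free_reduce)
  with Cons show ?case by (simp add: free_reduce_def)
qed (simp add: free_reduce_def)

lemma words_over_free_reduce: "w \<in> words_over S \<Longrightarrow> free_reduce w \<in> words_over S"
  using set_free_reduce[of w] by (auto simp: words_over_def)

lemma group_free_group: "group (free_group S)"
proof (rule groupI)
  fix u v assume "u \<in> carrier (free_group S)" "v \<in> carrier (free_group S)"
  then show "u \<otimes>\<^bsub>free_group S\<^esub> v \<in> carrier (free_group S)"
    using words_over_free_reduce[of "u @ v" S]
    by (auto simp: free_group_def reduced_free_reduce) (auto simp: words_over_def)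
next
  fix w assume w: "w \<in> carrier (free_group S)"
  let ?v = "free_reduce (map inv_letter (rev w))"
  have "map inv_letter (rev w) \<in> words_over S"
    using w by (force simp: free_group_def words_over_def)
  then have "?v \<in> carrier (free_group S)"
    by (simp add: free_group_def words_over_free_reduce reduced_free_reduce)
  moreover have "?v \<otimes>\<^bsub>free_group S\<^esub> w = \<one>\<^bsub>free_group S\<^esub>"
    by (simp add: free_group_def free_reduce_left free_reduce_inverse)
  ultimately show "\<exists>v\<in>carrier (free_group S). v \<otimes>\<^bsub>free_group S\<^esub> w = \<one>\<^bsub>free_group S\<^esub>"
    by blast
qed (simp_all add: free_group_def free_reduce_left free_reduce_right free_reduce_reduced,
     simp add: words_over_def)

lemma normal_normal_closure:
  assumes "group G" "R \<subseteq> carrier G"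
  shows "normal_closure G R \<lhd> G"
proof -
  interpret group G by fact
  have "carrier G \<lhd> G" by (simp add: normal_inv_iff subgroup_self)
  then have "subgroup (normal_closure G R) G"
    unfolding normal_closure_def
    using assms(2) by (intro subgroups_Inter) (auto intro: normal_imp_subgroup)
  moreover have "x \<otimes>\<^bsub>G\<^esub> h \<otimes>\<^bsub>G\<^esub> inv\<^bsub>G\<^esub> x \<in> normal_closure G R"
    if "x \<in> carrier G" "h \<in> normal_closure G R" for x h
    using that unfolding normal_closure_def by (auto simp: normal_inv_iff)
  ultimately show ?thesis by (simp add: normal_inv_iff)
qed

lemma group_presented_group:
  assumes "is_presentation n rs"
  shows "group (presented_group n rs)"
  unfolding presented_group_def
proof (intro normal.factorgroup_is_group normal_normal_closure group_free_group)
  show "free_reduce ` set rs \<subseteq> carrier (free_group {..<n})"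
    using assms by (auto simp: is_presentation_def free_group_def
        reduced_free_reduce words_over_free_reduce)
qed


section \<open>Large groups\<close>

definition finitely_generated :: "('a, 'b) monoid_scheme \<Rightarrow> bool" where
  "finitely_generated G \<longleftrightarrow> (\<exists>S. finite S \<and> S \<subseteq> carrier G \<and> generate G S = carrier G)"

text \<open>
  Free groups on subsets of \<^typ>\<open>nat\<close> suffice: a free quotient of a finite index subgroup of a
  finitely generated group is itself finitely generated, hence of finite rank.
\<close>

definition large :: "('a, 'b) monoid_scheme \<Rightarrow> bool" where
  "large G \<longleftrightarrow> group G \<and> finitely_generated G \<and>
     (\<exists>H. subgroup H G \<and> finite (rcosets\<^bsub>G\<^esub> H) \<and>
        (\<exists>(S :: nat set) h. \<not> comm_group (free_group S) \<and>
           h \<in> epi (G\<lparr>carrier := H\<rparr>) (free_group S)))"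

end

theory Submission
  imports Defs
begin

text \<open>
  Largeness is semidecidable because it has finite certificates.  Suppose that \<open>H\<close> is a subgroup of
  index \<open>k\<close> in \<open>G\<close> and that \<open>h\<close> maps \<open>H\<close> onto a free group \<open>F\<close>.  Choosing representatives for the
  cosets of \<open>H\<close> induces an action of \<open>G\<close> on \<open>{..<k} \<times> F\<close> that commutes with right multiplication
  by \<open>F\<close>: on the first component it is the action on cosets, and the second component is multiplied
  on the left by values of \<open>h\<close>.  Such an action is given by finitely many data, namely, for every
  letter and every \<open>j < k\<close>, a target point and a word in \<open>F\<close> called its label.

  Conversely, let a table of targets and labels be given.  It defines an action of \<open>G\<close> precisely if
  mutually inverse letters act as mutually inverse permutations and the relators act trivially.  By
  equivariance, both have to be tested only at the finitely many states \<open>(j, [])\<close>, and each test is a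
  computation with reduced words.  The elements that fix the point \<open>0\<close> then form a subgroup of index
  at most \<open>k\<close>, on which the label is a homomorphism into a free group.  Two words in the generators
  of \<open>G\<close> that fix \<open>0\<close> and have two different generators \<open>a\<close> and \<open>b\<close> as labels show that the
  homomorphism becomes surjective after killing all generators except \<open>a\<close> and \<open>b\<close>.

  Hence \<open>G\<close> is large if and only if it has a certificate (\<open>large_if_certified\<close>,
  \<open>certified_if_large\<close>).  Whether given data form a certificate is computable
  (\<open>computable_checks\<close>), so an unbounded search through all candidates is the required algorithm
  (\<open>semidecidable_ex\<close>).

  Kleene's codes compute with numbers only.  Computability is therefore developed for functions
  between types with an injective coding by numbers: the closure rules \<open>computable_intros\<close> apply
  directly to HOL functions on pairs and lists, and only the arithmetic of pairing is written in codes.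
\<close>

section \<open>Computable functions between coded types\<close>

class coded =
  fixes code :: "'a \<Rightarrow> nat"
  assumes inj_code: "inj code"

lemma code_eq_iff: "code x = code y \<longleftrightarrow> x = y"
  using inj_code by (auto dest: injD)

text \<open>
  The codes agree with those by which presentations are encoded
  (\<open>encode_presentation_eq_code\<close>).
\<close>

instantiation nat :: coded
begin
definition code_nat :: "nat \<Rightarrow> nat" where "code_nat n = n"
instance by standard (simp add: code_nat_def inj_def)
end

instantiation bool :: coded
begin
definition code_bool :: "bool \<Rightarrow> nat" where "code_bool b = of_bool b"
instance by standard (simp add: code_bool_def inj_def)
end

instantiation prod :: (coded, coded) coded
begin
definition code_prod :: "'a \<times> 'b \<Rightarrow> nat" where
  "code_prod p = prod_encode (code (fst p), code (snd p))"
instance by standard (auto simp: code_prod_def inj_def code_eq_iff prod_eq_iff)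
end

instantiation list :: (coded) coded
begin
definition code_list :: "'a list \<Rightarrow> nat" where "code_list xs = list_encode (map code xs)"
instance
  by standard (simp add: code_list_def inj_def list_encode_eq inj_map_eq_map[OF inj_code])
end

lemma encode_presentation_eq_code: "encode_presentation n rs = code (n, rs)"
proof -
  have "encode_word w = code w" for w
    by (auto simp: encode_word_def code_list_def code_prod_def code_nat_def code_bool_def
        intro!: arg_cong[where f = list_encode])
  then show ?thesis
    by (simp add: encode_presentation_def code_prod_def code_nat_def code_list_def cong: map_cong)
qed

definition computable :: "('a::coded \<Rightarrow> 'b::coded) \<Rightarrow> bool" where
  "computable f \<longleftrightarrow> (\<exists>A. \<forall>x. evaluates A [code x] (code (f x)))"

subsection \<open>Arithmetic\<close>

lemma evaluates_Proj: "i < length xs \<Longrightarrow> y = xs ! i \<Longrightarrow> evaluates (Proj i) xs y"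
  by (simp add: evaluates.Proj)

lemma evaluates_Comp1:
  "evaluates g xs y \<Longrightarrow> evaluates f [y] z \<Longrightarrow> evaluates (Comp f [g]) xs z"
  by (rule evaluates.Comp[where ys = "[y]"]) auto

lemma evaluates_Comp2:
  "evaluates g xs y \<Longrightarrow> evaluates g' xs y' \<Longrightarrow> evaluates f [y, y'] z \<Longrightarrow>
     evaluates (Comp f [g, g']) xs z"
  by (rule evaluates.Comp[where ys = "[y, y']"]) auto

lemma evaluates_Comp3:
  "evaluates g xs y \<Longrightarrow> evaluates g' xs y' \<Longrightarrow> evaluates g'' xs y'' \<Longrightarrow>
     evaluates f [y, y', y''] z \<Longrightarrow> evaluates (Comp f [g, g', g'']) xs z"
  by (rule evaluates.Comp[where ys = "[y, y', y'']"]) auto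

lemma evaluates_Prec:
  assumes "evaluates f xs (h 0)" "\<And>k. evaluates g (k # h k # xs) (h (Suc k))"
  shows "evaluates (Prec f g) (n # xs) (h n)"
  by (induction n) (auto intro: evaluates.intros assms)

lemmas evaluates_basic = evaluates_Comp1 evaluates_Comp2 evaluates_Comp3
  evaluates.Zero evaluates.Succ evaluates_Proj

definition "rf_add = Prec (Proj 0) (Comp Succ [Proj 1])"
definition "rf_pred = Prec Zero (Proj 0)"
definition "rf_sub = Prec (Proj 0) (Comp rf_pred [Proj 1])"
definition "rf_if0 = Prec (Proj 0) (Proj 3)"
definition "rf_triangle = Prec Zero (Comp rf_add [Proj 1, Comp Succ [Proj 0]])"
definition "rf_pair = Comp rf_add [Comp rf_triangle [rf_add], Proj 0]"

lemma rf_add: "evaluates rf_add [m, n] (m + n)"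
  unfolding rf_add_def
  by (rule evaluates_Prec[where h = "\<lambda>m. m + n"]) (auto intro!: evaluates_basic)

lemma rf_pred: "evaluates rf_pred [n] (n - 1)"
  unfolding rf_pred_def
  by (rule evaluates_Prec[where h = "\<lambda>m. m - 1"]) (auto intro!: evaluates_basic)

lemma rf_sub: "evaluates rf_sub [m, n] (n - m)"
  unfolding rf_sub_def
proof (rule evaluates_Prec[where h = "\<lambda>m. n - m"])
  show "evaluates (Comp rf_pred [Proj 1]) [k, n - k, n] (n - Suc k)" for k
    using evaluates_Comp1[OF evaluates_Proj[of 1 _ "n - k"] rf_pred, of "[k, n - k, n]"] by simp
qed (simp add: evaluates_Proj)

lemma rf_if0: "evaluates rf_if0 [c, a, b] (if c = 0 then a else b)"
  unfolding rf_if0_def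
  by (rule evaluates_Prec[where h = "\<lambda>c. if c = 0 then a else b"]) (auto intro!: evaluates_basic)

lemma rf_triangle: "evaluates rf_triangle [n] (triangle n)"
  unfolding rf_triangle_def
proof (rule evaluates_Prec[where h = triangle])
  show "evaluates (Comp rf_add [Proj 1, Comp Succ [Proj 0]]) [k, triangle k] (triangle (Suc k))" for k
    unfolding triangle_Suc by (rule evaluates_Comp2[OF _ _ rf_add]) (auto intro!: evaluates_basic)
qed (simp add: evaluates.Zero)

lemma rf_pair: "evaluates rf_pair [m, n] (prod_encode (m, n))"
proof -
  have "evaluates (Proj 0) [m, n] m" by (simp add: evaluates_Proj)
  then show ?thesis
    unfolding rf_pair_def prod_encode_def
    using evaluates_Comp2[OF evaluates_Comp1[OF rf_add rf_triangle] _ rf_add] by simp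
qed

text \<open>
  The number of the diagonal on which the pair coded by \<open>z\<close> lies is the largest \<open>d\<close> with
  \<^term>\<open>triangle d \<le> z\<close>.  It determines both components, and unlike the pair itself it satisfies a
  primitive recursion in which only one number has to be remembered.
\<close>

definition diagonal :: "nat \<Rightarrow> nat" where
  "diagonal z = fst (prod_decode z) + snd (prod_decode z)"

lemma code_eq_triangle_diagonal: "z = triangle (diagonal z) + fst (prod_decode z)"
  using prod_decode_inverse[of z]
  by (cases "prod_decode z") (simp add: diagonal_def prod_encode_def)

lemma diagonal_eqI:
  assumes "triangle d \<le> z" "z < triangle (Suc d)"
  shows "diagonal z = d"
proof -
  have "prod_encode (z - triangle d, d - (z - triangle d)) = z"
    using assms by (simp add: prod_encode_def)
  then have "prod_decode z = (z - triangle d, d - (z - triangle d))"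
    by (metis prod_encode_inverse)
  with assms show ?thesis by (simp add: diagonal_def)
qed

lemma diagonal_bounds: "triangle (diagonal z) \<le> z" "z < triangle (Suc (diagonal z))"
  using code_eq_triangle_diagonal[of z] by (auto simp: diagonal_def)

lemma diagonal_0: "diagonal 0 = 0"
  by (rule diagonal_eqI) auto

lemma diagonal_Suc:
  "diagonal (Suc z) =
     (if triangle (Suc (diagonal z)) - Suc z = 0 then Suc (diagonal z) else diagonal z)"
proof (cases "triangle (Suc (diagonal z)) \<le> Suc z")
  case True
  have "Suc z < triangle (Suc (Suc (diagonal z)))"
    using diagonal_bounds(2)[of z] by simp
  with True have "diagonal (Suc z) = Suc (diagonal z)" by (rule diagonal_eqI)
  with True show ?thesis by (simp del: triangle_Suc)
next
  case False
  have "triangle (diagonal z) \<le> Suc z"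
    using diagonal_bounds(1)[of z] by simp
  then have "diagonal (Suc z) = diagonal z" using False by (intro diagonal_eqI) simp_all
  with False show ?thesis by (simp del: triangle_Suc)
qed

definition "rf_diagonal = Prec Zero (Comp rf_if0
  [Comp rf_sub [Comp Succ [Proj 0], Comp rf_triangle [Comp Succ [Proj 1]]], Comp Succ [Proj 1], Proj 1])"
definition "rf_fst = Comp rf_sub [Comp rf_triangle [rf_diagonal], Proj 0]"
definition "rf_snd = Comp rf_sub [rf_fst, rf_diagonal]"

lemma rf_diagonal: "evaluates rf_diagonal [z] (diagonal z)"
  unfolding rf_diagonal_def
proof (rule evaluates_Prec[where h = diagonal], goal_cases)
  case (2 z)
  let ?xs = "[z, diagonal z]"
  have proj: "evaluates (Proj 0) ?xs z" "evaluates (Proj 1) ?xs (diagonal z)"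
    by (auto intro!: evaluates_Proj)
  note Suc = this[THEN evaluates_Comp1, OF evaluates.Succ]
  show ?case
    unfolding diagonal_Suc
    by (rule evaluates_Comp3[OF evaluates_Comp2[OF Suc(1) evaluates_Comp1[OF Suc(2) rf_triangle] rf_sub]
          Suc(2) proj(2) rf_if0])
qed (simp add: diagonal_0 evaluates.Zero)

lemma rf_fst: "evaluates rf_fst [z] (fst (prod_decode z))"
proof -
  have "fst (prod_decode z) = z - triangle (diagonal z)"
    using code_eq_triangle_diagonal[of z] by simp
  then show ?thesis
    unfolding rf_fst_def
    using evaluates_Comp2[OF evaluates_Comp1[OF rf_diagonal rf_triangle] evaluates_Proj[of 0] rf_sub, of z z]
    by simp
qed

lemma rf_snd: "evaluates rf_snd [z] (snd (prod_decode z))"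
proof -
  have "snd (prod_decode z) = diagonal z - fst (prod_decode z)"
    by (simp add: diagonal_def)
  then show ?thesis
    unfolding rf_snd_def using evaluates_Comp2[OF rf_fst rf_diagonal rf_sub, of z] by simp
qed

subsection \<open>Closure properties\<close>

named_theorems computable_intros

lemma computable_ident [computable_intros]: "computable (\<lambda>x. x)"
  unfolding computable_def by (intro exI[of _ "Proj 0"]) (simp add: evaluates_Proj)

lemma evaluates_const: "\<exists>A. \<forall>x. evaluates A [x] m"
proof (induction m)
  case (Suc m)
  then show ?case by (meson evaluates_Comp1 evaluates.Succ)
qed (auto intro: evaluates.Zero)

lemma computable_const [computable_intros]: "computable (\<lambda>x. c)"
  using evaluates_const[of "code c"] unfolding computable_def by blast

lemma computable_compose: "computable f \<Longrightarrow> computable g \<Longrightarrow> computable (\<lambda>x. f (g x))"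
  unfolding computable_def by (meson evaluates_Comp1)

lemma computable_of_evaluates1:
  assumes "\<And>x. evaluates R [code x] (code (f x))" "computable g"
  shows "computable (\<lambda>x. f (g x))"
  using assms unfolding computable_def by (meson evaluates_Comp1)

lemma computable_of_evaluates2:
  assumes "\<And>x y. evaluates R [code x, code y] (code (f x y))" "computable g" "computable h"
  shows "computable (\<lambda>x. f (g x) (h x))"
  using assms unfolding computable_def by (meson evaluates_Comp2)

lemma computable_Pair [computable_intros]:
  "computable f \<Longrightarrow> computable g \<Longrightarrow> computable (\<lambda>x. (f x, g x))"
  by (rule computable_of_evaluates2[where R = rf_pair]) (simp_all add: code_prod_def rf_pair)

lemma computable_fst [computable_intros]: "computable f \<Longrightarrow> computable (\<lambda>x. fst (f x))"
proof (rule computable_of_evaluates1[where R = rf_fst and f = fst])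
  show "evaluates rf_fst [code p] (code (fst p))" for p :: "'b \<times> 'c"
    using rf_fst[of "code p"] by (simp add: code_prod_def)
qed

lemma computable_snd [computable_intros]: "computable f \<Longrightarrow> computable (\<lambda>x. snd (f x))"
proof (rule computable_of_evaluates1[where R = rf_snd and f = snd])
  show "evaluates rf_snd [code p] (code (snd p))" for p :: "'b \<times> 'c"
    using rf_snd[of "code p"] by (simp add: code_prod_def)
qed

text \<open>
  Computability is a notion for unary functions, but the operations on lists take curried functions;
  the next two rules mediate.
\<close>

lemma computable_compose2:
  assumes "computable (\<lambda>p. f (fst p) (snd p))" "computable g" "computable h"
  shows "computable (\<lambda>x. f (g x) (h x))"
  using computable_compose[OF assms(1) computable_Pair[OF assms(2,3)]] by simp

lemma computable_compose3:
  assumes "computable (\<lambda>p. f (fst p) (fst (snd p)) (snd (snd p)))"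
    "computable g" "computable h" "computable k"
  shows "computable (\<lambda>x. f (g x) (h x) (k x))"
  using computable_compose[OF assms(1) computable_Pair[OF assms(2) computable_Pair[OF assms(3,4)]]]
  by simp

lemma computable_if [computable_intros]:
  assumes "computable p" "computable f" "computable g"
  shows "computable (\<lambda>x. if p x then f x else g x)"
proof -
  obtain P F G where P: "\<And>x. evaluates P [code x] (code (p x))"
    and F: "\<And>x. evaluates F [code x] (code (f x))" and G: "\<And>x. evaluates G [code x] (code (g x))"
    using assms unfolding computable_def by metis
  have "evaluates (Comp rf_if0 [P, G, F]) [code x] (code (if p x then f x else g x))" for x
    using evaluates_Comp3[OF P G F rf_if0, of x]
    by (simp add: code_bool_def if_distrib[where f = code] split: if_splits)
  then show ?thesis unfolding computable_def by blast
qed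

lemma computable_conj [computable_intros]:
  "computable p \<Longrightarrow> computable q \<Longrightarrow> computable (\<lambda>x. p x \<and> q x)"
  by (rule back_subst[where P = computable, OF computable_if[OF _ _ computable_const[of False], of p q]]) auto

lemma computable_Not [computable_intros]: "computable p \<Longrightarrow> computable (\<lambda>x. \<not> p x)"
  by (rule back_subst[where P = computable,
        OF computable_if[OF _ computable_const[of False] computable_const[of True]]]) auto

lemma computable_Suc [computable_intros]: "computable f \<Longrightarrow> computable (\<lambda>x. Suc (f x))"
  by (rule computable_of_evaluates1[where R = Succ]) (simp_all add: code_nat_def evaluates.Succ)

lemma computable_code [computable_intros]: "computable f \<Longrightarrow> computable (\<lambda>x. code (f x))"
  by (rule computable_of_evaluates1[where R = "Proj 0" and f = code])
     (auto simp: code_nat_def intro!: evaluates_Proj)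

lemma computable_diff [computable_intros]:
  fixes f g :: "'a::coded \<Rightarrow> nat"
  shows "computable f \<Longrightarrow> computable g \<Longrightarrow> computable (\<lambda>x. f x - g x)"
  by (rule computable_of_evaluates2[where R = rf_sub and f = "\<lambda>m n. n - m"])
     (simp_all add: code_nat_def rf_sub)

lemma computable_eq_0 [computable_intros]:
  fixes f :: "'a::coded \<Rightarrow> nat"
  assumes "computable f"
  shows "computable (\<lambda>x. f x = 0)"
proof -
  have "evaluates (Comp rf_if0 [Proj 0, Comp Succ [Zero], Zero]) [code n] (code (n = 0))" for n :: nat
    using rf_if0[of n "Suc 0" 0]
    by (auto intro!: evaluates_Comp3[where f = rf_if0] evaluates_basic
        simp: code_nat_def code_bool_def split: if_splits)
  then show ?thesis
    using assms by (rule computable_of_evaluates1[where f = "\<lambda>n. n = 0"])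
qed

lemma computable_le [computable_intros]:
  fixes f g :: "'a::coded \<Rightarrow> nat"
  assumes "computable f" "computable g"
  shows "computable (\<lambda>x. f x \<le> g x)"
proof -
  have "computable (\<lambda>x. f x - g x = 0)" by (intro computable_intros assms)
  then show ?thesis by simp
qed

lemma computable_less [computable_intros]:
  fixes f g :: "'a::coded \<Rightarrow> nat"
  assumes "computable f" "computable g"
  shows "computable (\<lambda>x. f x < g x)"
proof -
  have "computable (\<lambda>x. Suc (f x) \<le> g x)" by (intro computable_intros assms)
  then show ?thesis by (simp add: Suc_le_eq)
qed

lemma computable_eq [computable_intros]:
  assumes "computable f" "computable g"
  shows "computable (\<lambda>x. f x = g x)"
proof -
  have "computable (\<lambda>x. code (f x) \<le> code (g x) \<and> code (g x) \<le> code (f x))"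
    by (intro computable_intros assms)
  moreover have "f x = g x \<longleftrightarrow> code (f x) \<le> code (g x) \<and> code (g x) \<le> code (f x)" for x
    using code_eq_iff[of "f x" "g x"] by auto
  ultimately show ?thesis by simp
qed

text \<open>
  Carrying the parameter \<open>x\<close> along as an extra argument of the recursion reduces this rule to Kleene's
  primitive recursion; the arguments of the step are packed into one pair because computable
  functions are unary.
\<close>

lemma computable_rec_nat [computable_intros]:
  assumes "computable (\<lambda>p. s (fst p) (fst (snd p)) (snd (snd p)))" "computable a" "computable n"
  shows "computable (\<lambda>x. rec_nat (a x) (s x) (n x))"
proof -
  obtain S A N where S: "\<And>p. evaluates S [code p] (code (s (fst p) (fst (snd p)) (snd (snd p))))"
    and A: "\<And>x. evaluates A [code x] (code (a x))" and N: "\<And>x. evaluates N [code x] (n x)"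
    using assms unfolding computable_def code_nat_def by metis
  let ?P = "Prec A (Comp S [Comp rf_pair [Proj 2, Comp rf_pair [Proj 0, Proj 1]]])"
  have "evaluates ?P [m, code x] (code (rec_nat (a x) (s x) m))" for m x
  proof (rule evaluates_Prec[where h = "\<lambda>m. code (rec_nat (a x) (s x) m)"])
    fix k
    let ?r = "rec_nat (a x) (s x) k"
    have "prod_encode (code x, prod_encode (k, code ?r)) = code (x, k, ?r)"
      by (simp add: code_prod_def code_nat_def)
    with S[of "(x, k, ?r)"]
    have "evaluates S [prod_encode (code x, prod_encode (k, code ?r))] (code (rec_nat (a x) (s x) (Suc k)))"
      by simp
    then show "evaluates (Comp S [Comp rf_pair [Proj 2, Comp rf_pair [Proj 0, Proj 1]]])
          [k, code ?r, code x] (code (rec_nat (a x) (s x) (Suc k)))"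
      by (intro evaluates_Comp1[OF evaluates_Comp2[OF _ evaluates_Comp2[OF _ _ rf_pair] rf_pair]])
         (auto intro!: evaluates_Proj)
  qed (simp add: A)
  then have "evaluates (Comp ?P [N, Proj 0]) [code x] (code (rec_nat (a x) (s x) (n x)))" for x
    by (intro evaluates_Comp2[OF N]) (auto intro!: evaluates_Proj)
  then show ?thesis unfolding computable_def by blast
qed

subsection \<open>Lists\<close>

lemma computable_Cons [computable_intros]:
  assumes "computable f" "computable g"
  shows "computable (\<lambda>x. f x # g x)"
  using assms
proof (rule computable_of_evaluates2[rotated])
  show "evaluates (Comp Succ [rf_pair]) [code x, code xs] (code (x # xs))"
    for x :: 'b and xs :: "'b list"
    by (auto intro!: evaluates_basic rf_pair simp: code_list_def evaluates.Succ)
qed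

lemma computable_tl [computable_intros]:
  assumes "computable f"
  shows "computable (\<lambda>x. tl (f x))"
proof -
  have "evaluates (Comp rf_snd [rf_pred]) [code xs] (code (tl xs))" for xs :: "'b list"
  proof -
    have "prod_decode 0 = (0, 0)"
      using prod_encode_inverse[of "(0, 0)"] by (simp add: prod_encode_def)
    then have "code (tl xs) = snd (prod_decode (code xs - 1))"
      by (cases xs) (simp_all add: code_list_def)
    then show ?thesis using evaluates_Comp1[OF rf_pred rf_snd] by simp
  qed
  then show ?thesis using assms by (rule computable_of_evaluates1)
qed

text \<open>
  The value of \<^term>\<open>hd []\<close> is an unspecified constant; whatever its code is, some code of a recursive
  function outputs it.
\<close>

lemma computable_hd [computable_intros]:
  assumes "computable f"
  shows "computable (\<lambda>x. hd (f x))"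
proof -
  obtain C where C: "\<And>x :: nat. evaluates C [x] (code (hd [] :: 'b))"
    using evaluates_const by blast
  have "evaluates (Comp rf_if0 [Proj 0, C, Comp rf_fst [rf_pred]]) [code xs] (code (hd xs))"
    for xs :: "'b list"
  proof -
    have "code (hd xs) =
        (if code xs = 0 then code (hd [] :: 'b) else fst (prod_decode (code xs - 1)))"
      by (cases xs) (simp_all add: code_list_def)
    then show ?thesis
      using evaluates_Comp3[OF evaluates_Proj[of 0] C evaluates_Comp1[OF rf_pred rf_fst] rf_if0] by simp
  qed
  then show ?thesis using assms by (rule computable_of_evaluates1)
qed

lemma length_le_code: "length xs \<le> code xs"
proof (induction xs)
  case (Cons x xs)
  have "code xs \<le> prod_encode (code x, code xs)" by (rule le_prod_encode_2)
  with Cons show ?case by (simp add: code_list_def)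
qed simp

text \<open>
  Folding is iteration of a step that moves the head of the list into the accumulator and does
  nothing once the list is exhausted; the code of the list bounds the number of steps.
\<close>

lemma computable_fold:
  assumes "computable (\<lambda>p. f (fst p) (fst (snd p)) (snd (snd p)))" "computable xs" "computable a"
  shows "computable (\<lambda>x. fold (f x) (xs x) (a x))"
proof -
  define step where "step x k p =
    (tl (fst p), if fst p = [] then snd p else f x (hd (fst p)) (snd p))" for x and k :: nat and p
  have step: "snd (rec_nat (ys, b) (step x) m) = fold (f x) (take m ys) b \<and>
      fst (rec_nat (ys, b) (step x) m) = drop m ys" for x ys b m
  proof (induction m)
    case (Suc m)
    then show ?case
      by (cases "m < length ys")
         (simp_all add: step_def take_Suc_conv_app_nth hd_drop_conv_nth drop_Suc tl_drop)
  qed simp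
  have "fold (f x) (xs x) (a x) = snd (rec_nat (xs x, a x) (step x) (code (xs x)))" for x
    by (simp add: step length_le_code)
  moreover have "computable (\<lambda>x. snd (rec_nat (xs x, a x) (step x) (code (xs x))))"
    unfolding step_def by (intro computable_intros computable_compose3[OF assms(1)] assms(2,3))
  ultimately show ?thesis by simp
qed

lemma computable_rev [computable_intros]:
  assumes "computable f"
  shows "computable (\<lambda>x. rev (f x))"
proof -
  have "computable (\<lambda>x. fold (\<lambda>y ys. y # ys) (f x) [])"
    by (intro computable_fold computable_intros assms)
  then show ?thesis by (simp add: rev_conv_fold)
qed

lemma computable_foldr [computable_intros]:
  assumes "computable (\<lambda>p. f (fst p) (fst (snd p)) (snd (snd p)))" "computable xs" "computable a"
  shows "computable (\<lambda>x. foldr (f x) (xs x) (a x))"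
  unfolding foldr_conv_fold by (intro computable_fold computable_intros assms)

lemma computable_map [computable_intros]:
  assumes "computable (\<lambda>p. f (fst p) (snd p))" "computable xs"
  shows "computable (\<lambda>x. map (f x) (xs x))"
proof -
  have "computable (\<lambda>x. foldr (\<lambda>y ys. f x y # ys) (xs x) [])"
    by (intro computable_intros computable_compose2[OF assms(1)] assms(2))
  moreover have "foldr (\<lambda>y ys. g y # ys) zs [] = map g zs" for g :: "'b \<Rightarrow> 'c" and zs
    by (induction zs) auto
  ultimately show ?thesis by simp
qed

lemma computable_list_all [computable_intros]:
  assumes "computable (\<lambda>p. f (fst p) (snd p))" "computable xs"
  shows "computable (\<lambda>x. list_all (f x) (xs x))"
proof -
  have "computable (\<lambda>x. foldr (\<lambda>y b. f x y \<and> b) (xs x) True)"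
    by (intro computable_intros computable_compose2[OF assms(1)] assms(2))
  moreover have "foldr (\<lambda>y b. g y \<and> b) zs True = list_all g zs" for g :: "'b \<Rightarrow> bool" and zs
    by (induction zs) auto
  ultimately show ?thesis by simp
qed

lemma computable_all_less [computable_intros]:
  fixes f :: "'a::coded \<Rightarrow> nat \<Rightarrow> bool"
  assumes "computable (\<lambda>p. f (fst p) (snd p))" "computable n"
  shows "computable (\<lambda>x. \<forall>i < n x. f x i)"
proof -
  have "computable (\<lambda>x. rec_nat True (\<lambda>i b. f x i \<and> b) (n x))"
    by (intro computable_intros computable_compose2[OF assms(1)] assms(2))
  moreover have "rec_nat True (\<lambda>i b. g i \<and> b) m = (\<forall>i < m. g i)" for g :: "nat \<Rightarrow> bool" and m
    by (induction m) (auto simp: less_Suc_eq)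
  ultimately show ?thesis by simp
qed

subsection \<open>Searching for a certificate\<close>

text \<open>
  The search runs through the natural numbers, so it needs a computable way to turn numbers into
  candidates.  Codes of Boolean values are not all numbers, hence the coding itself cannot be
  inverted for this purpose; a surjection is enough.
\<close>

definition enumeration :: "(nat \<Rightarrow> 'a::coded) \<Rightarrow> bool" where
  "enumeration d \<longleftrightarrow> computable d \<and> surj d"

lemma enumeration_nat: "enumeration (\<lambda>n. n)"
  by (simp add: enumeration_def computable_ident)

lemma enumeration_bool: "enumeration (\<lambda>n. n = 0)"
proof -
  have "b = (of_bool (\<not> b) = (0 :: nat))" for b by simp
  then have "surj (\<lambda>n :: nat. n = 0)" by (rule surjI[OF sym])
  then show ?thesis unfolding enumeration_def by (intro conjI computable_intros)
qed

lemma computable_fst_prod_decode [computable_intros]: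
  "computable f \<Longrightarrow> computable (\<lambda>x. fst (prod_decode (f x)))"
  by (rule computable_of_evaluates1[where R = rf_fst and f = "\<lambda>z. fst (prod_decode z)"])
     (simp_all add: code_nat_def rf_fst)

lemma computable_snd_prod_decode [computable_intros]:
  "computable f \<Longrightarrow> computable (\<lambda>x. snd (prod_decode (f x)))"
  by (rule computable_of_evaluates1[where R = rf_snd and f = "\<lambda>z. snd (prod_decode z)"])
     (simp_all add: code_nat_def rf_snd)

lemma enumeration_prod:
  assumes "enumeration d" "enumeration e"
  shows "enumeration (\<lambda>z. (d (fst (prod_decode z)), e (snd (prod_decode z))))"
proof -
  have "computable d" "computable e" and *: "surj d" "surj e"
    using assms by (auto simp: enumeration_def)
  note [computable_intros] = computable_compose[OF this(1)] computable_compose[OF this(2)]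
  have "\<exists>z. (x, y) = (d (fst (prod_decode z)), e (snd (prod_decode z)))" for x y
  proof -
    from * obtain i j where "x = d i" "y = e j" by (meson surjD)
    then show ?thesis by (intro exI[of _ "prod_encode (i, j)"]) simp
  qed
  then show ?thesis unfolding enumeration_def surj_def
    by (intro conjI computable_intros) auto
qed

lemma enumeration_list:
  assumes "enumeration d"
  shows "enumeration (\<lambda>z. map d (list_decode z))"
proof -
  have d: "computable d" "surj d" using assms by (auto simp: enumeration_def)
  have "map (code :: nat \<Rightarrow> nat) = (\<lambda>xs. xs)" by (auto simp: code_nat_def[abs_def])
  then have "evaluates (Proj 0) [code z] (code (list_decode z))" for z :: nat
    by (auto intro!: evaluates_Proj simp: code_nat_def code_list_def)
  then have "computable (\<lambda>z. list_decode z)"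
    unfolding computable_def by blast
  then have "computable (\<lambda>z. map d (list_decode z))"
    by (intro computable_intros computable_compose[OF d(1)])
  moreover have "surj (\<lambda>z. map d (list_decode z))"
  proof (rule surjI)
    show "map d (list_decode (list_encode (map (inv_into UNIV d) ys))) = ys" for ys
      using d(2) by (induction ys) (simp_all add: surj_f_inv_f)
  qed
  ultimately show ?thesis by (simp add: enumeration_def)
qed

text \<open>
  Since the test of a candidate always terminates, minimization applied to it finds a certificate
  whenever there is one, and diverges otherwise.
\<close>

lemma semidecidable_ex:
  fixes P :: "'a::coded \<Rightarrow> 'b::coded \<Rightarrow> bool"
  assumes "computable (\<lambda>p. P (fst p) (snd p))" "enumeration (d :: nat \<Rightarrow> 'b)"
  shows "\<exists>A. \<forall>x. answers_yes A (code x) \<longleftrightarrow> (\<exists>c. P x c)"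
proof -
  have d: "computable d" "surj d" using assms by (auto simp: enumeration_def)
  have "computable (\<lambda>q. \<not> P (snd q) (d (fst q)))"
    by (intro computable_intros computable_compose2[OF assms(1)] computable_compose[OF d(1)])
  then obtain F where F: "\<And>q. evaluates F [code q] (of_bool (\<not> P (snd q) (d (fst q))))"
    unfolding computable_def code_bool_def by blast
  define G where "G = Comp F [rf_pair]"
  have G: "evaluates G [i, code x] (of_bool (\<not> P x (d i)))" for i x
    using evaluates_Comp1[OF rf_pair[of i "code x"], of F] F[of "(i, x)"]
    by (simp add: G_def code_prod_def code_nat_def)
  define A where "A = Comp (Comp Succ [Zero]) [Mu G]"
  have "answers_yes A (code x) \<longleftrightarrow> (\<exists>c. P x c)" for x
  proof
    assume "answers_yes A (code x)"
    then obtain i where "evaluates (Mu G) [code x] i"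
      unfolding answers_yes_def A_def
      by (auto elim!: evaluates_CompE simp: list_all2_Cons1)
    then have "evaluates G [i, code x] 0" by (auto elim: evaluates_MuE)
    with G[of i x] have "P x (d i)" by (auto dest: evaluates_unique)
    then show "\<exists>c. P x c" by blast
  next
    assume "\<exists>c. P x c"
    then have ex: "\<exists>i. P x (d i)" using d(2) by (metis surjD)
    define i where "i = (LEAST i. P x (d i))"
    have "P x (d i)" using ex unfolding i_def by (rule LeastI_ex)
    moreover have "\<not> P x (d j)" if "j < i" for j using that not_less_Least i_def by blast
    ultimately have "evaluates G [i, code x] 0" "\<And>j. j < i \<Longrightarrow> evaluates G [j, code x] (Suc 0)"
      using G[of _ x] by (metis of_bool_eq(1), metis of_bool_eq(2) One_nat_def)
    then have "evaluates (Mu G) [code x] i"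
      by (blast intro: evaluates.Mu)
    then show "answers_yes A (code x)"
      unfolding answers_yes_def A_def by (auto intro!: evaluates_basic)
  qed
  then show ?thesis by blast
qed

section \<open>Certificates of largeness\<close>

text \<open>
  The pair \<^term>\<open>\<delta> l j\<close> consists of the target and the label of the letter \<open>l\<close> at the point \<open>j\<close>.  A word
  acts from the left, its last letter first, so that concatenation of words becomes composition.
\<close>

fun act_letter :: "('p letter \<Rightarrow> nat \<Rightarrow> nat \<times> 'q word) \<Rightarrow> 'p letter \<Rightarrow> nat \<times> 'q word \<Rightarrow> nat \<times> 'q word"
  where "act_letter \<delta> l (j, w) = (fst (\<delta> l j), foldr push_letter (snd (\<delta> l j)) w)"

definition act :: "('p letter \<Rightarrow> nat \<Rightarrow> nat \<times> 'q word) \<Rightarrow> 'p word \<Rightarrow> nat \<times> 'q word \<Rightarrow> nat \<times> 'q word"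
  where "act \<delta> w = foldr (act_letter \<delta>) w"

text \<open>
  The conditions say that \<open>\<delta>\<close> defines an action of the presented group on the points below \<open>k\<close>
  together with labels, and that \<open>u\<close> and \<open>v\<close> are loops at the point \<open>0\<close> labelled by two different
  generators.  The letters of the labels range over all of \<^typ>\<open>nat\<close>.
\<close>

definition certifies_large :: "nat \<Rightarrow> nat word list \<Rightarrow> nat \<Rightarrow> (nat letter \<Rightarrow> nat \<Rightarrow> nat \<times> nat word) \<Rightarrow>
    nat \<Rightarrow> nat \<Rightarrow> nat word \<Rightarrow> nat word \<Rightarrow> bool" where
  "certifies_large n rs k \<delta> a b u v \<longleftrightarrow>
     0 < k \<and> a \<noteq> b \<and>
     (\<forall>i<n. \<forall>j<k. \<forall>c. fst (\<delta> (i, c) j) < k \<and> act \<delta> [(i, c), (i, \<not> c)] (j, []) = (j, [])) \<and>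
     list_all (\<lambda>r. \<forall>j<k. act \<delta> r (j, []) = (j, [])) rs \<and>
     list_all (\<lambda>l. fst l < n) u \<and> act \<delta> u (0, []) = (0, [(a, True)]) \<and>
     list_all (\<lambda>l. fst l < n) v \<and> act \<delta> v (0, []) = (0, [(b, True)])"

type_synonym table = "((nat letter \<times> nat) \<times> nat \<times> nat word) list"

text \<open>
  The default value for missing entries is arbitrary: a table is judged by the action that it defines,
  with the defaults included.
\<close>

definition lookup :: "table \<Rightarrow> nat letter \<Rightarrow> nat \<Rightarrow> nat \<times> nat word" where
  "lookup T l j = foldr (\<lambda>e d. if fst e = (l, j) then snd e else d) T (0, [])"

fun checks :: "nat \<times> nat word list \<Rightarrow> nat \<times> table \<times> (nat \<times> nat) \<times> nat word \<times> nat word \<Rightarrow> bool" where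
  "checks (n, rs) (k, T, (a, b), u, v) = certifies_large n rs k (lookup T) a b u v"

lemma lookup_table:
  assumes "finite A"
  shows "\<exists>T. \<forall>l j. (l, j) \<in> A \<longrightarrow> lookup T l j = \<delta> l j"
proof -
  obtain ps where ps: "set ps = A" using finite_list[OF assms] by blast
  have "(l, j) \<in> set ps \<Longrightarrow> lookup (map (\<lambda>(l, j). ((l, j), \<delta> l j)) ps) l j = \<delta> l j" for l j
    by (induction ps) (auto simp: lookup_def)
  with ps show ?thesis by blast
qed

subsection \<open>Checking certificates is computable\<close>

lemma computable_push_letter [computable_intros]:
  assumes "computable f" "computable g"
  shows "computable (\<lambda>x. push_letter (f x) (g x))"
proof -
  have "push_letter l w =
      (if w = [] then [l] else if hd w = (fst l, \<not> snd l) then tl w else l # w)"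
    for l :: "'b letter" and w
    by (cases w; cases l) auto
  then show ?thesis by (simp only:) (intro computable_intros assms)
qed

lemma computable_lookup [computable_intros]:
  assumes "computable T" "computable l" "computable j"
  shows "computable (\<lambda>x. lookup (T x) (l x) (j x))"
  unfolding lookup_def
  by (intro computable_intros assms[THEN computable_compose] assms)

lemma computable_act_lookup [computable_intros]:
  assumes "computable T" "computable w" "computable s"
  shows "computable (\<lambda>x. act (lookup (T x)) (w x) (s x))"
proof -
  have *: "act \<delta> w = foldr (\<lambda>l s. (fst (\<delta> l (fst s)), foldr push_letter (snd (\<delta> l (fst s))) (snd s))) w"
    for \<delta> :: "nat letter \<Rightarrow> nat \<Rightarrow> nat \<times> nat word" and w
    unfolding act_def by (intro arg_cong2[where f = foldr] ext refl) auto
  show ?thesis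
    unfolding * by (intro computable_intros assms(1)[THEN computable_compose] assms)
qed

lemma computable_checks: "computable (\<lambda>p. checks (fst p) (snd p))"
proof -
  have "checks p c = certifies_large (fst p) (snd p) (fst c) (lookup (fst (snd c)))
      (fst (fst (snd (snd c)))) (snd (fst (snd (snd c))))
      (fst (snd (snd (snd c)))) (snd (snd (snd (snd c))))" for p c
    by (cases p; cases c) auto
  then show ?thesis
    unfolding certifies_large_def all_bool_eq by (simp only:) (intro computable_intros)
qed

lemma semidecidable_checks:
  "\<exists>A. \<forall>n rs. answers_yes A (encode_presentation n rs) \<longleftrightarrow> (\<exists>c. checks (n, rs) c)"
proof -
  note letter = enumeration_prod[OF enumeration_nat enumeration_bool]
  note word = enumeration_list[OF letter]
  note table = enumeration_list[OF enumeration_prod[OF enumeration_prod[OF letter enumeration_nat]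
        enumeration_prod[OF enumeration_nat word]]]
  note certificate = enumeration_prod[OF enumeration_nat enumeration_prod[OF table
        enumeration_prod[OF enumeration_prod[OF enumeration_nat enumeration_nat]
          enumeration_prod[OF word word]]]]
  show ?thesis
    using semidecidable_ex[OF computable_checks certificate]
    unfolding encode_presentation_eq_code by blast
qed

section \<open>Free groups and presented groups\<close>

lemma mem_carrier_free_group: "w \<in> carrier (free_group S) \<longleftrightarrow> w \<in> words_over S \<and> reduced w"
  by (simp add: free_group_def)

lemma mult_free_group: "u \<otimes>\<^bsub>free_group S\<^esub> v = free_reduce (u @ v)"
  by (simp add: free_group_def)

lemma one_free_group: "\<one>\<^bsub>free_group S\<^esub> = []"
  by (simp add: free_group_def)

lemma words_over_Nil: "[] \<in> words_over S"
  by (simp add: words_over_def)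

lemma words_over_Cons: "l # w \<in> words_over S \<longleftrightarrow> fst l \<in> S \<and> w \<in> words_over S"
  by (auto simp: words_over_def)

lemma words_over_append: "u @ v \<in> words_over S \<longleftrightarrow> u \<in> words_over S \<and> v \<in> words_over S"
  by (auto simp: words_over_def)

lemmas words_over_simps = words_over_Nil words_over_Cons words_over_append

lemma foldr_push_letter_reduced: "reduced v \<Longrightarrow> foldr push_letter u v = free_reduce (u @ v)"
  by (simp add: free_reduce_append free_reduce_reduced)

lemma free_reduce_in_carrier: "w \<in> words_over S \<Longrightarrow> free_reduce w \<in> carrier (free_group S)"
  by (simp add: mem_carrier_free_group words_over_free_reduce reduced_free_reduce)

text \<open>
  The generators generate a free group.  This form, with a homomorphism, yields generators of quotients
  as well.
\<close>

lemma hom_free_group_into_subgroup: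
  assumes T: "group T" "\<phi> \<in> hom (free_group S) T" "subgroup K T"
    and gens: "\<And>s. s \<in> S \<Longrightarrow> \<phi> [(s, True)] \<in> K"
    and w: "w \<in> carrier (free_group S)"
  shows "\<phi> w \<in> K"
proof -
  interpret group_hom "free_group S" T \<phi>
    using T group_free_group by (auto simp: group_hom_def group_hom_axioms_def)
  have letter: "\<phi> [l] \<in> K" if "fst l \<in> S" for l
  proof (cases l)
    case (Pair s c)
    with that have s: "[(s, True)] \<in> carrier (free_group S)" "[(s, False)] \<in> carrier (free_group S)"
      by (auto simp: mem_carrier_free_group words_over_simps)
    have "[(s, False)] \<otimes>\<^bsub>free_group S\<^esub> [(s, True)] = \<one>\<^bsub>free_group S\<^esub>"
      by (simp add: mult_free_group one_free_group free_reduce_def)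
    then have "[(s, False)] = inv\<^bsub>free_group S\<^esub> [(s, True)]"
      using s by (metis G.inv_equality)
    then have "\<phi> [(s, False)] = inv\<^bsub>T\<^esub> (\<phi> [(s, True)])"
      using s by simp
    then show ?thesis
      using Pair that gens[of s] subgroup.m_inv_closed[OF T(3)] by (cases c) auto
  qed
  from w show ?thesis
  proof (induction w)
    case Nil
    then show ?case using hom_one subgroup.one_closed[OF T(3)] by (simp add: one_free_group)
  next
    case (Cons l w)
    then have w: "w \<in> carrier (free_group S)" and l: "[l] \<in> carrier (free_group S)"
      by (auto simp: mem_carrier_free_group words_over_simps dest: reduced_Cons_Cons)
    have "l # w = [l] \<otimes>\<^bsub>free_group S\<^esub> w"
      using Cons.prems by (simp add: mult_free_group free_reduce_reduced mem_carrier_free_group)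
    then have "\<phi> (l # w) = \<phi> [l] \<otimes>\<^bsub>T\<^esub> \<phi> w" using l w by simp
    then show ?case
      using Cons w letter[of l] subgroup.m_closed[OF T(3)]
      by (simp add: mem_carrier_free_group words_over_simps)
  qed
qed

lemma free_group_generated:
  assumes "subgroup K (free_group S)" "\<And>s. s \<in> S \<Longrightarrow> [(s, True)] \<in> K"
  shows "K = carrier (free_group S)"
proof -
  have "w \<in> K" if "w \<in> carrier (free_group S)" for w
    using hom_free_group_into_subgroup[where \<phi> = "\<lambda>x. x", OF group_free_group _ assms(1) assms(2) that]
    by (simp add: hom_def)
  with subgroup.subset[OF assms(1)] show ?thesis by blast
qed

lemma (in group) subgroup_centralizer:
  assumes "g \<in> carrier G"
  shows "subgroup {x \<in> carrier G. x \<otimes> g = g \<otimes> x} G"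
proof (rule subgroupI)
  fix x assume "x \<in> {x \<in> carrier G. x \<otimes> g = g \<otimes> x}"
  then have x: "x \<in> carrier G" "x \<otimes> g = g \<otimes> x" by auto
  have "inv x \<otimes> g = inv x \<otimes> (g \<otimes> x) \<otimes> inv x"
    using x(1) assms by (simp add: m_assoc)
  also have "\<dots> = g \<otimes> inv x"
    unfolding x(2)[symmetric] using x(1) assms by (simp add: m_assoc[symmetric])
  finally show "inv x \<in> {x \<in> carrier G. x \<otimes> g = g \<otimes> x}" using x(1) by simp
next
  fix x y assume "x \<in> {x \<in> carrier G. x \<otimes> g = g \<otimes> x}" "y \<in> {x \<in> carrier G. x \<otimes> g = g \<otimes> x}"
  then have xy: "x \<in> carrier G" "x \<otimes> g = g \<otimes> x" "y \<in> carrier G" "y \<otimes> g = g \<otimes> y" by auto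
  have "x \<otimes> y \<otimes> g = x \<otimes> g \<otimes> y"
    using xy(1,3) assms by (simp add: m_assoc xy(4))
  also have "\<dots> = g \<otimes> (x \<otimes> y)"
    using xy(1,3) assms by (simp add: m_assoc xy(2))
  finally show "x \<otimes> y \<in> {x \<in> carrier G. x \<otimes> g = g \<otimes> x}" using xy by simp
qed (use assms in auto)

lemma comm_group_free_group_iff: "comm_group (free_group S) \<longleftrightarrow> (\<forall>a\<in>S. \<forall>b\<in>S. a = b)"
proof
  assume comm: "comm_group (free_group S)"
  show "\<forall>a\<in>S. \<forall>b\<in>S. a = b"
  proof (intro ballI)
    fix a b assume "a \<in> S" "b \<in> S"
    then have "[(a, True)] \<in> carrier (free_group S)" "[(b, True)] \<in> carrier (free_group S)"
      by (simp_all add: mem_carrier_free_group words_over_simps)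
    then have "[(a, True)] \<otimes>\<^bsub>free_group S\<^esub> [(b, True)] = [(b, True)] \<otimes>\<^bsub>free_group S\<^esub> [(a, True)]"
      by (rule comm_monoid.m_comm[OF comm_group.axioms(1)[OF comm]])
    from arg_cong[where f = hd, OF this] show "a = b"
      by (simp add: mult_free_group free_reduce_def)
  qed
next
  assume S: "\<forall>a\<in>S. \<forall>b\<in>S. a = b"
  interpret group "free_group S" by (rule group_free_group)
  \<comment> \<open>The centralizer of a generator contains all generators, so generators are central; hence the
      centralizer of any element contains all generators.\<close>
  let ?C = "\<lambda>g. {x \<in> carrier (free_group S). x \<otimes>\<^bsub>free_group S\<^esub> g = g \<otimes>\<^bsub>free_group S\<^esub> x}"
  have gen: "[(s, True)] \<in> carrier (free_group S)" if "s \<in> S" for s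
    using that by (simp add: mem_carrier_free_group words_over_simps)
  have "?C [(s, True)] = carrier (free_group S)" if "s \<in> S" for s
    using S that by (intro free_group_generated subgroup_centralizer gen) (auto simp: gen)
  then have "g \<in> ?C [(s, True)]" if "g \<in> carrier (free_group S)" "s \<in> S" for g s
    using that by (simp only:)
  then have "[(s, True)] \<otimes>\<^bsub>free_group S\<^esub> g = g \<otimes>\<^bsub>free_group S\<^esub> [(s, True)]"
    if "g \<in> carrier (free_group S)" "s \<in> S" for g s
    using that by simp
  then have "?C g = carrier (free_group S)" if "g \<in> carrier (free_group S)" for g
    using that by (intro free_group_generated subgroup_centralizer) (auto simp: gen)
  then show "comm_group (free_group S)"
    by (intro group_comm_groupI) blast
qed

text \<open>
  The retraction of a free group that kills the generators outside \<open>S\<close>.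
\<close>

definition keep_letters :: "'a set \<Rightarrow> 'a word \<Rightarrow> 'a word" where
  "keep_letters S w = free_reduce (filter (\<lambda>l. fst l \<in> S) w)"

text \<open>
  Deleting letters turns a cancelling pair into a cancelling pair or into nothing.
\<close>

lemma keep_letters_free_reduce: "keep_letters S (free_reduce w) = keep_letters S w"
proof (induction w)
  case (Cons l w)
  let ?f = "filter (\<lambda>l. fst l \<in> S)"
  have push: "free_reduce (?f (push_letter l v)) = free_reduce (?f (l # v))" for v
  proof (cases v)
    case (Cons m v')
    have "push_letter l (push_letter (inv_letter l) (free_reduce (?f v'))) = free_reduce (?f v')"
      by (rule push_letter_inv_letter) (rule reduced_free_reduce)
    with Cons show ?thesis by (cases l) (auto simp: free_reduce_def)
  qed simp
  have "free_reduce (l # w) = push_letter l (free_reduce w)" by (simp add: free_reduce_def)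
  then have "keep_letters S (free_reduce (l # w)) = free_reduce (?f (l # free_reduce w))"
    by (simp add: keep_letters_def push)
  also have "\<dots> = keep_letters S (l # w)"
    using Cons by (simp add: keep_letters_def) (simp add: free_reduce_def)
  finally show ?case .
qed (simp add: free_reduce_def)

lemma keep_letters_append:
  "keep_letters S (free_reduce (u @ v)) = free_reduce (keep_letters S u @ keep_letters S v)"
  unfolding keep_letters_free_reduce
  by (simp add: keep_letters_def free_reduce_left free_reduce_right)

lemma keep_letters_in_carrier: "keep_letters S w \<in> carrier (free_group S)"
  unfolding keep_letters_def by (intro free_reduce_in_carrier) (auto simp: words_over_def)

locale presentation =
  fixes n :: nat and rs :: "nat word list"
  assumes presentation: "is_presentation n rs"
begin

abbreviation "W \<equiv> words_over {..<n}"
abbreviation "F \<equiv> free_group {..<n}"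
abbreviation "N \<equiv> normal_closure F (free_reduce ` set rs)"
abbreviation "G \<equiv> presented_group n rs"

text \<open>
  The element of the presented group that is represented by a word.
\<close>

definition cls :: "nat word \<Rightarrow> nat word set" where
  "cls w = N #>\<^bsub>F\<^esub> free_reduce w"

lemma relators_in_carrier: "free_reduce ` set rs \<subseteq> carrier F"
  using presentation by (auto simp: is_presentation_def intro!: free_reduce_in_carrier)

lemma normal_N: "N \<lhd> F"
  by (intro normal_normal_closure group_free_group relators_in_carrier)

sublocale G: group G
  using presentation by (rule group_presented_group)

lemma N_subset: "K \<lhd> F \<Longrightarrow> free_reduce ` set rs \<subseteq> K \<Longrightarrow> N \<subseteq> K"
  by (auto simp: normal_closure_def)

lemma G_eq: "G = F Mod N"
  by (simp add: presented_group_def)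

lemma cls_closed [simp, intro]: "w \<in> W \<Longrightarrow> cls w \<in> carrier G"
  unfolding G_eq cls_def by (auto simp: FactGroup_def RCOSETS_def intro: free_reduce_in_carrier)

lemma cls_surj: "C \<in> carrier G \<Longrightarrow> \<exists>w\<in>W. cls w = C"
  unfolding G_eq cls_def
  by (auto simp: FactGroup_def RCOSETS_def mem_carrier_free_group) (metis free_reduce_reduced)

lemma cls_append: "u \<in> W \<Longrightarrow> v \<in> W \<Longrightarrow> cls (u @ v) = cls u \<otimes>\<^bsub>G\<^esub> cls v"
  unfolding G_eq cls_def
  by (simp add: normal.rcos_sum[OF normal_N] free_reduce_in_carrier mult_free_group
      free_reduce_left free_reduce_right)

lemma cls_free_reduce: "cls (free_reduce w) = cls w"
  by (simp add: cls_def free_reduce_reduced reduced_free_reduce)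

lemma cls_Nil: "cls [] = \<one>\<^bsub>G\<^esub>"
proof -
  have "cls [] = N #>\<^bsub>F\<^esub> \<one>\<^bsub>F\<^esub>" by (simp add: cls_def free_reduce_def one_free_group)
  also have "\<dots> = N"
    by (intro group.coset_mult_one group_free_group subgroup.subset normal_imp_subgroup normal_N)
  finally show ?thesis by (simp add: G_eq)
qed

lemma cls_relator: "r \<in> set rs \<Longrightarrow> cls r = \<one>\<^bsub>G\<^esub>"
proof -
  assume r: "r \<in> set rs"
  have "N #>\<^bsub>F\<^esub> free_reduce r = N"
  proof (rule group.coset_join2[OF group_free_group])
    show "free_reduce r \<in> carrier F" using relators_in_carrier r by blast
    show "free_reduce r \<in> N" using r by (auto simp: normal_closure_def)
  qed (rule normal_imp_subgroup[OF normal_N])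
  then show ?thesis by (simp add: cls_def G_eq)
qed

lemma cls_cancel: "cls [(i, c), (i, \<not> c)] = \<one>\<^bsub>G\<^esub>"
  using cls_free_reduce[of "[(i, c), (i, \<not> c)]"] by (simp add: free_reduce_def cls_Nil)

text \<open>
  The universal property of the presentation: to show that two words representing the same element
  have the same effect, it is enough to exhibit a normal subgroup of words without effect that
  contains the relators.
\<close>

lemma cls_eq_imp:
  assumes "K \<lhd> F" "free_reduce ` set rs \<subseteq> K" "u \<in> W" "cls u = cls v"
  shows "\<exists>w\<in>K. free_reduce u = free_reduce (w @ v)"
proof -
  have "free_reduce u \<in> cls u"
    unfolding cls_def
    by (intro group.rcos_self group_free_group normal_imp_subgroup normal_N free_reduce_in_carrier assms)
  then have "free_reduce u \<in> N #>\<^bsub>F\<^esub> free_reduce v" using assms(4) by (simp add: cls_def)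
  then obtain w where "w \<in> N" "free_reduce u = free_reduce (w @ free_reduce v)"
    by (auto simp: r_coset_def mult_free_group)
  then show ?thesis using N_subset[OF assms(1,2)] by (auto simp: free_reduce_right)
qed

lemma finitely_generated_G: "finitely_generated G"
proof -
  let ?gens = "(\<lambda>i. cls [(i, True)]) ` {..<n}"
  have gens: "?gens \<subseteq> carrier G" by (auto simp: words_over_simps)
  have "cls \<in> hom F G"
    by (auto simp: hom_def mem_carrier_free_group mult_free_group cls_free_reduce cls_append)
  then have "cls w \<in> generate G ?gens" if "w \<in> carrier F" for w
    using hom_free_group_into_subgroup[OF G.is_group _ G.generate_is_subgroup[OF gens] _ that]
    by (auto intro: generate.incl)
  then have "C \<in> generate G ?gens" if "C \<in> carrier G" for C
    using cls_surj[OF that] by (metis cls_free_reduce free_reduce_in_carrier)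
  then have "carrier G \<subseteq> generate G ?gens" by blast
  then show ?thesis
    unfolding finitely_generated_def using gens G.generate_incl[OF gens]
    by (intro exI[of _ ?gens]) auto
qed

end

section \<open>A certificate proves largeness\<close>

lemma act_Nil: "act \<delta> [] s = s"
  by (simp add: act_def)

lemma act_Cons: "act \<delta> (l # w) s = act_letter \<delta> l (act \<delta> w s)"
  by (simp add: act_def)

lemma act_append: "act \<delta> (u @ v) s = act \<delta> u (act \<delta> v s)"
  by (simp add: act_def)

lemma act_letter_eq: "act_letter \<delta> l s = (fst (\<delta> l (fst s)), foldr push_letter (snd (\<delta> l (fst s))) (snd s))"
  by (cases s) simp

lemma reduced_act: "reduced (snd s) \<Longrightarrow> reduced (snd (act \<delta> w s))"
  by (induction w) (auto simp: act_Nil act_Cons act_letter_eq reduced_foldr_push_letter)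

text \<open>
  The action commutes with right multiplication on the second component, because letters multiply
  from the left.  Everything about the action on \<open>(j, x)\<close> can thus be read off from \<open>(j, [])\<close>.
\<close>

lemma act_equivariant:
  assumes "reduced x"
  shows "act \<delta> w (j, x) =
     (fst (act \<delta> w (j, [])), free_reduce (snd (act \<delta> w (j, [])) @ x))"
proof (induction w)
  case Nil
  show ?case using assms by (simp add: act_Nil free_reduce_reduced)
next
  case (Cons l w)
  have "reduced (snd (act \<delta> w (j, [])))" by (simp add: reduced_act)
  then show ?case
    by (simp add: act_Cons act_letter_eq Cons foldr_push_letter_reduced reduced_free_reduce
        free_reduce_left free_reduce_right)
qed

locale action = presentation +
  fixes k :: nat and \<delta> :: "nat letter \<Rightarrow> nat \<Rightarrow> nat \<times> nat word"
  assumes k_pos: "0 < k"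
    and closed: "\<And>i j c. i < n \<Longrightarrow> j < k \<Longrightarrow> fst (\<delta> (i, c) j) < k"
    and inverse: "\<And>i j c. i < n \<Longrightarrow> j < k \<Longrightarrow> act \<delta> [(i, c), (i, \<not> c)] (j, []) = (j, [])"
    and relators: "\<And>r j. r \<in> set rs \<Longrightarrow> j < k \<Longrightarrow> act \<delta> r (j, []) = (j, [])"
begin

definition X :: "(nat \<times> nat word) set" where
  "X = {..<k} \<times> {w. reduced w}"

lemma act_X: "w \<in> W \<Longrightarrow> s \<in> X \<Longrightarrow> act \<delta> w s \<in> X"
proof (induction w)
  case (Cons l w)
  then show ?case
    by (cases l) (auto simp: act_Cons act_letter_eq X_def words_over_simps closed reduced_foldr_push_letter
       mem_Times_iff)
qed (simp add: act_Nil)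

lemma act_fixes:
  assumes "\<And>j. j < k \<Longrightarrow> act \<delta> w (j, []) = (j, [])" "s \<in> X"
  shows "act \<delta> w s = s"
  using assms act_equivariant[of "snd s" \<delta> w "fst s"] by (auto simp: X_def free_reduce_reduced)

lemma act_inv_letter:
  assumes "fst l < n" "s \<in> X"
  shows "act_letter \<delta> l (act_letter \<delta> (inv_letter l) s) = s"
proof (cases l)
  case (Pair i c)
  have "i < n" using assms(1) Pair by simp
  then have "act \<delta> [(i, c), (i, \<not> c)] s = s"
    by (rule act_fixes[OF inverse assms(2)])
  with Pair show ?thesis by (simp add: act_Cons act_Nil)
qed

text \<open>
  Free cancellation is invisible to the action since inverse letters act inversely.
\<close>

lemma act_free_reduce:
  assumes "w \<in> W" "s \<in> X"
  shows "act \<delta> (free_reduce w) s = act \<delta> w s"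
  using assms(1)
proof (induction w)
  case (Cons l w)
  have push: "act \<delta> (push_letter l v) s = act \<delta> (l # v) s" if "v \<in> W" for v
  proof (cases v)
    case (Cons m v')
    then have "act_letter \<delta> l (act_letter \<delta> (inv_letter l) (act \<delta> v' s)) = act \<delta> v' s"
      using Cons \<open>l # w \<in> W\<close> that assms(2) by (intro act_inv_letter act_X) (auto simp: words_over_simps)
    then show ?thesis using Cons by (simp add: act_Cons)
  qed simp
  have "free_reduce (l # w) = push_letter l (free_reduce w)" by (simp add: free_reduce_def)
  then show ?case
    using Cons by (simp add: push words_over_free_reduce words_over_simps act_Cons)
qed (simp add: free_reduce_def)

lemma normal_acts_trivially: "{w \<in> carrier F. \<forall>s\<in>X. act \<delta> w s = s} \<lhd> F" (is "?K \<lhd> F")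
proof -
  interpret F: group F by (rule group_free_group)
  have act_mult: "act \<delta> (u \<otimes>\<^bsub>F\<^esub> v) s = act \<delta> u (act \<delta> v s)"
    if "u \<in> carrier F" "v \<in> carrier F" "s \<in> X" for u v s
    using that by (simp add: mult_free_group act_free_reduce mem_carrier_free_group words_over_simps act_append)
  have act_one: "act \<delta> \<one>\<^bsub>F\<^esub> s = s" for s
    by (simp add: one_free_group act_Nil)
  have act_inv: "act \<delta> u (act \<delta> (inv\<^bsub>F\<^esub> u) s) = s" if "u \<in> carrier F" "s \<in> X" for u s
    using act_mult[of u "inv\<^bsub>F\<^esub> u" s] that by (simp add: act_one)
  have act_F: "act \<delta> u s \<in> X" if "u \<in> carrier F" "s \<in> X" for u s
    using that act_X by (simp add: mem_carrier_free_group)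
  have "subgroup ?K F"
  proof (rule F.subgroupI)
    show "?K \<noteq> {}" using act_one F.one_closed by blast
    fix u assume u: "u \<in> ?K"
    then show "inv\<^bsub>F\<^esub> u \<in> ?K" using act_inv[of u] act_F[of "inv\<^bsub>F\<^esub> u"] by auto
    fix v assume "v \<in> ?K"
    with u show "u \<otimes>\<^bsub>F\<^esub> v \<in> ?K" by (auto simp: act_mult)
  qed auto
  moreover have "x \<otimes>\<^bsub>F\<^esub> w \<otimes>\<^bsub>F\<^esub> inv\<^bsub>F\<^esub> x \<in> ?K" if "x \<in> carrier F" "w \<in> ?K" for x w
    using that by (auto simp: act_mult act_inv act_F)
  ultimately show ?thesis by (simp add: F.normal_inv_iff)
qed

text \<open>
  By the universal property, the action descends from words to the presented group.
\<close>

lemma act_cls: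
  assumes "cls u = cls v" "u \<in> W" "v \<in> W" "s \<in> X"
  shows "act \<delta> u s = act \<delta> v s"
proof -
  have "act \<delta> (free_reduce r) s = s" if "r \<in> set rs" "s \<in> X" for r s
    using that presentation act_fixes[OF relators, of r s]
    by (auto simp: act_free_reduce is_presentation_def)
  then have "free_reduce ` set rs \<subseteq> {w \<in> carrier F. \<forall>s\<in>X. act \<delta> w s = s}"
    using relators_in_carrier by auto
  from cls_eq_imp[OF normal_acts_trivially this assms(2,1)]
  obtain w where w: "w \<in> carrier F" "\<forall>s\<in>X. act \<delta> w s = s" "free_reduce u = free_reduce (w @ v)"
    by blast
  have "act \<delta> u s = act \<delta> (free_reduce (w @ v)) s"
    using assms w(3) by (metis act_free_reduce)
  also have "\<dots> = act \<delta> w (act \<delta> v s)"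
    using assms w(1) by (simp add: act_free_reduce words_over_simps mem_carrier_free_group act_append)
  also have "\<dots> = act \<delta> v s" using w(2) assms act_X by blast
  finally show ?thesis .
qed

abbreviation "start \<equiv> (0 :: nat, [] :: nat word)"

lemma start_X: "start \<in> X"
  using k_pos by (simp add: X_def)

definition stabilizer :: "nat word set set" where
  "stabilizer = cls ` {w \<in> W. fst (act \<delta> w start) = 0}"

text \<open>
  The label of a loop at \<open>0\<close>, transported to the group elements; any representing word will do
  (\<open>label_cls\<close>).
\<close>

definition label :: "nat word set \<Rightarrow> nat word" where
  "label C = snd (act \<delta> (SOME w. w \<in> W \<and> cls w = C) start)"

lemma label_cls: "w \<in> W \<Longrightarrow> label (cls w) = snd (act \<delta> w start)"
  unfolding label_def
  by (rule someI2[where a = w]) (simp, rule arg_cong[where f = snd], rule act_cls, simp_all add: start_X)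

lemma cls_in_stabilizer:
  assumes w: "w \<in> W"
  shows "cls w \<in> stabilizer \<longleftrightarrow> fst (act \<delta> w start) = 0"
proof
  assume "cls w \<in> stabilizer"
  then obtain v where v: "v \<in> W" "cls w = cls v" "fst (act \<delta> v start) = 0"
    by (auto simp: stabilizer_def)
  with act_cls[OF v(2) w v(1) start_X] show "fst (act \<delta> w start) = 0" by simp
qed (use w in \<open>simp add: stabilizer_def\<close>)

text \<open>
  The cocycle identity: the label of a product is the product of the labels along the path.
\<close>

lemma act_append_start:
  fixes u v defines "j \<equiv> fst (act \<delta> v start)"
  shows "act \<delta> (u @ v) start =
    (fst (act \<delta> u (j, [])), free_reduce (snd (act \<delta> u (j, [])) @ snd (act \<delta> v start)))"
proof -
  have "reduced (snd (act \<delta> v start))" by (rule reduced_act) simp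
  from act_equivariant[OF this] show ?thesis
    unfolding j_def act_append by (metis prod.collapse)
qed

lemma subgroup_stabilizer: "subgroup stabilizer G"
proof (rule G.subgroupI)
  show "stabilizer \<subseteq> carrier G" by (auto simp: stabilizer_def)
  have "cls [] \<in> stabilizer" by (subst cls_in_stabilizer) (simp_all add: act_Nil words_over_simps)
  then show "stabilizer \<noteq> {}" by blast
next
  fix C assume "C \<in> stabilizer"
  then obtain w where w: "w \<in> W" "C = cls w" "fst (act \<delta> w start) = 0"
    by (auto simp: stabilizer_def)
  obtain w' where w': "w' \<in> W" "cls w' = inv\<^bsub>G\<^esub> C"
    using cls_surj w by blast
  have "cls (w' @ w) = cls []"
    using w w' by (simp add: cls_append cls_Nil)
  then have "act \<delta> (w' @ w) start = start"
    using act_cls[of "w' @ w" "[]" start] w w' by (simp add: start_X words_over_simps act_Nil)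
  with w(3) have "fst (act \<delta> w' start) = 0"
    by (simp add: act_append_start)
  with w' show "inv\<^bsub>G\<^esub> C \<in> stabilizer" using cls_in_stabilizer by metis
next
  fix C D assume "C \<in> stabilizer" "D \<in> stabilizer"
  then obtain u v where uv: "u \<in> W" "v \<in> W" "C = cls u" "D = cls v"
    "fst (act \<delta> u start) = 0" "fst (act \<delta> v start) = 0"
    by (auto simp: stabilizer_def)
  then have "cls (u @ v) \<in> stabilizer"
    by (subst cls_in_stabilizer) (auto simp: words_over_simps act_append_start)
  with uv show "C \<otimes>\<^bsub>G\<^esub> D \<in> stabilizer" by (simp add: cls_append)
qed

lemma label_mult:
  assumes "C \<in> stabilizer" "D \<in> stabilizer"
  shows "label (C \<otimes>\<^bsub>G\<^esub> D) = free_reduce (label C @ label D)"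
proof -
  obtain u v where uv: "u \<in> W" "v \<in> W" "C = cls u" "D = cls v" "fst (act \<delta> v start) = 0"
    using assms by (auto simp: stabilizer_def)
  have "label (cls (u @ v)) = free_reduce (label (cls u) @ label (cls v))"
    using uv by (simp add: label_cls words_over_simps act_append_start)
  with uv show ?thesis by (simp add: cls_append)
qed

text \<open>
  The right coset of the inverse of an element is determined by the point to which the element moves
  \<open>0\<close>, and there are only \<open>k\<close> points.
\<close>

lemma finite_rcosets_stabilizer: "finite (rcosets\<^bsub>G\<^esub> stabilizer)"
proof -
  let ?p = "\<lambda>w. fst (act \<delta> w start)"
  let ?coset = "\<lambda>w. stabilizer #>\<^bsub>G\<^esub> (inv\<^bsub>G\<^esub> cls w)"
  have same: "?coset u = ?coset v" if uv: "u \<in> W" "v \<in> W" "?p u = ?p v" for u v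
  proof -
    obtain w where w: "w \<in> W" "cls w = inv\<^bsub>G\<^esub> cls v" using cls_surj uv(2) by blast
    have "cls (w @ v) = cls []" using w uv by (simp add: cls_append cls_Nil)
    then have "act \<delta> (w @ v) start = start"
      using act_cls[of "w @ v" "[]" start] w uv by (simp add: start_X words_over_simps act_Nil)
    then have "?p (w @ u) = 0"
      using uv(3) by (simp add: act_append_start)
    then have "cls (w @ u) \<in> stabilizer"
      using w uv by (simp add: cls_in_stabilizer words_over_simps)
    then have "(inv\<^bsub>G\<^esub> cls v) \<otimes>\<^bsub>G\<^esub> inv\<^bsub>G\<^esub> (inv\<^bsub>G\<^esub> cls u) \<in> stabilizer"
      using w uv by (simp add: cls_append)
    then have "inv\<^bsub>G\<^esub> cls v \<in> ?coset u"
      using uv by (subst subgroup.rcos_module[OF subgroup_stabilizer G.is_group]) auto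
    then show ?thesis
      using uv by (intro G.repr_independence subgroup_stabilizer) auto
  qed
  have "rcosets\<^bsub>G\<^esub> stabilizer \<subseteq> ?coset ` W"
  proof
    fix Y assume "Y \<in> rcosets\<^bsub>G\<^esub> stabilizer"
    then obtain C where C: "C \<in> carrier G" "Y = stabilizer #>\<^bsub>G\<^esub> C" by (auto simp: RCOSETS_def)
    then obtain w where "w \<in> W" "cls w = inv\<^bsub>G\<^esub> C" using cls_surj G.inv_closed by blast
    with C show "Y \<in> ?coset ` W" by (intro image_eqI[of _ _ w]) auto
  qed
  also have "?coset ` W \<subseteq> (\<lambda>j. ?coset (SOME w. w \<in> W \<and> ?p w = j)) ` {..<k}"
  proof
    fix Y assume "Y \<in> ?coset ` W"
    then obtain w where w: "w \<in> W" "Y = ?coset w" by blast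
    have "?p w < k" using act_X[OF w(1) start_X] by (auto simp: X_def)
    moreover have "(SOME v. v \<in> W \<and> ?p v = ?p w) \<in> W \<and> ?p (SOME v. v \<in> W \<and> ?p v = ?p w) = ?p w"
      by (rule someI[of _ w]) (simp add: w(1))
    then have "?coset (SOME v. v \<in> W \<and> ?p v = ?p w) = Y"
      unfolding w(2) using w(1) by (intro same) auto
    ultimately show "Y \<in> (\<lambda>j. ?coset (SOME w. w \<in> W \<and> ?p w = j)) ` {..<k}" by blast
  qed
  finally show ?thesis by (rule finite_subset) simp
qed

text \<open>
  The retraction onto the free group on \<open>a\<close> and \<open>b\<close> fixes the labels of the two loops, so the labels
  of the stabilizer are mapped onto that group.
\<close>

lemma large_if_two_generators:
  assumes "a \<noteq> b" "u \<in> W" "act \<delta> u start = (0, [(a, True)])" "v \<in> W" "act \<delta> v start = (0, [(b, True)])"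
  shows "large G"
proof -
  let ?S = "{a, b}" and ?h = "\<lambda>C. keep_letters {a, b} (label C)"
  let ?H = "G\<lparr>carrier := stabilizer\<rparr>"
  have hom: "?h \<in> hom ?H (free_group ?S)"
    by (auto simp: hom_def keep_letters_in_carrier label_mult keep_letters_append mult_free_group)
  then interpret h: group_hom ?H "free_group ?S" ?h
    using G.subgroup_imp_group[OF subgroup_stabilizer] group_free_group
    by (simp add: group_hom_def group_hom_axioms_def)
  have "cls u \<in> stabilizer" "?h (cls u) = [(a, True)]" "cls v \<in> stabilizer" "?h (cls v) = [(b, True)]"
    using assms by (simp_all add: cls_in_stabilizer label_cls keep_letters_def free_reduce_def)
  then have "[(s, True)] \<in> ?h ` carrier ?H" if "s \<in> ?S" for s
    using that by (auto intro: rev_image_eqI)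
  from free_group_generated[OF h.img_is_subgroup this]
  have "?h \<in> epi ?H (free_group ?S)" using hom by (simp add: epi_def)
  moreover have "\<not> comm_group (free_group ?S)"
    using assms(1) by (auto simp: comm_group_free_group_iff)
  ultimately show ?thesis
    unfolding large_def
    using G.is_group finitely_generated_G subgroup_stabilizer finite_rcosets_stabilizer by blast
qed

end

lemma words_over_lessThan: "w \<in> words_over {..<n} \<longleftrightarrow> list_all (\<lambda>l. fst l < n) w"
  by (auto simp: words_over_def list_all_iff)

lemma large_if_certified:
  assumes "is_presentation n rs" "certifies_large n rs k \<delta> a b u v"
  shows "large (presented_group n rs)"
proof -
  interpret action n rs k \<delta>
    using assms by unfold_locales (auto simp: certifies_large_def list_all_iff)
  show ?thesis
    using assms(2) by (intro large_if_two_generators[of a b u v])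
      (auto simp: certifies_large_def words_over_lessThan)
qed

section \<open>A large group has a certificate\<close>

context presentation
begin

text \<open>
  The points are the right cosets \<open>H t\<^sub>j\<close> with \<open>t\<^sub>0 = 1\<close>.  An element \<open>g\<close> sends \<open>H t\<^sub>j\<close> to
  \<open>H t\<^sub>j g\<^sup>-\<^sup>1 = H t\<^sub>i\<close>, and its label is the value of \<open>h\<close> at the element \<open>t\<^sub>i g t\<^sub>j\<^sup>-\<^sup>1\<close> of \<open>H\<close>.
  The inverse turns the right action on right cosets into a left action, so that the elements
  \<open>t\<^sub>i g t\<^sub>j\<^sup>-\<^sup>1\<close> along a product multiply in the same order as its factors.  At the point \<open>0\<close>, an element of
  \<open>H\<close> is its own return element, which makes all values of \<open>h\<close> occur as labels of loops.
\<close>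

lemma certified_if_large:
  assumes "large G"
  shows "\<exists>c. checks (n, rs) c"
proof -
  obtain H and S :: "nat set" and h where H: "subgroup H G" "finite (rcosets\<^bsub>G\<^esub> H)"
    and S: "\<not> comm_group (free_group S)" and h: "h \<in> epi (G\<lparr>carrier := H\<rparr>) (free_group S)"
    using assms unfolding large_def by blast
  obtain a b where ab: "a \<in> S" "b \<in> S" "a \<noteq> b"
    using S by (auto simp: comm_group_free_group_iff)
  note G.m_assoc [simp]
  have H_carrier: "H \<subseteq> carrier G" using H(1) by (rule subgroup.subset)
  have h_mult: "h (x \<otimes>\<^bsub>G\<^esub> y) = free_reduce (h x @ h y)" if "x \<in> H" "y \<in> H" for x y
    using h that by (auto simp: epi_def hom_def mult_free_group)
  have h_carrier: "h x \<in> carrier (free_group S)" if "x \<in> H" for x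
    using h that by (auto simp: epi_def hom_def)
  have h_one: "h \<one>\<^bsub>G\<^esub> = []"
  proof -
    have "h \<in> hom (G\<lparr>carrier := H\<rparr>) (free_group S)" using h by (simp add: epi_def)
    then have "h \<one>\<^bsub>G\<lparr>carrier := H\<rparr>\<^esub> = \<one>\<^bsub>free_group S\<^esub>"
      by (rule hom_one) (intro G.subgroup_imp_group H group_free_group)+
    then show ?thesis by (simp add: one_free_group)
  qed
  have "H \<in> rcosets\<^bsub>G\<^esub> H"
    using H(1) by (rule subgroup.subgroup_in_rcosets) (rule G.is_group)
  obtain cs where cs: "set cs = rcosets\<^bsub>G\<^esub> H - {H}" "distinct cs"
    using finite_distinct_list[of "rcosets\<^bsub>G\<^esub> H - {H}"] H(2) by auto
  \<comment> \<open>The cosets are listed with \<open>H\<close> first because loops of a certificate start at the point \<open>0\<close>.\<close>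
  define ps where "ps = H # cs"
  define k where "k = length ps"
  have ps: "set ps = rcosets\<^bsub>G\<^esub> H" "distinct ps" "ps ! 0 = H" and k: "0 < k"
    using cs \<open>H \<in> rcosets\<^bsub>G\<^esub> H\<close> by (auto simp: ps_def k_def)
  define t where "t j = (if j = 0 then \<one>\<^bsub>G\<^esub> else SOME g. g \<in> carrier G \<and> H #>\<^bsub>G\<^esub> g = ps ! j)" for j
  define \<tau> where "\<tau> g = (SOME j. j < k \<and> ps ! j = H #>\<^bsub>G\<^esub> g)" for g
  have t0: "t 0 = \<one>\<^bsub>G\<^esub>" by (simp add: t_def)
  have t: "t j \<in> carrier G" "H #>\<^bsub>G\<^esub> t j = ps ! j" if "j < k" for j
  proof -
    have "ps ! j \<in> rcosets\<^bsub>G\<^esub> H" using that ps(1) nth_mem by (auto simp: k_def)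
    then have "\<exists>g. g \<in> carrier G \<and> H #>\<^bsub>G\<^esub> g = ps ! j" by (auto simp: RCOSETS_def)
    then have "t j \<in> carrier G \<and> H #>\<^bsub>G\<^esub> t j = ps ! j"
      using G.coset_mult_one[OF H_carrier] by (cases "j = 0") (simp_all add: t_def ps(3), rule someI_ex)
    then show "t j \<in> carrier G" "H #>\<^bsub>G\<^esub> t j = ps ! j" by auto
  qed
  have \<tau>: "\<tau> g < k" "ps ! \<tau> g = H #>\<^bsub>G\<^esub> g" if "g \<in> carrier G" for g
  proof -
    have "H #>\<^bsub>G\<^esub> g \<in> set ps" using that ps(1) by (auto simp: RCOSETS_def)
    then have "\<exists>j. j < k \<and> ps ! j = H #>\<^bsub>G\<^esub> g" by (auto simp: in_set_conv_nth k_def)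
    from someI_ex[OF this] show "\<tau> g < k" "ps ! \<tau> g = H #>\<^bsub>G\<^esub> g"
      unfolding \<tau>_def by blast+
  qed
  have \<tau>_cong: "\<tau> g = \<tau> g'" if "H #>\<^bsub>G\<^esub> g = H #>\<^bsub>G\<^esub> g'" for g g'
    using that by (simp add: \<tau>_def)
  have \<tau>_t: "\<tau> (t j) = j" if "j < k" for j
    using \<tau>[of "t j"] t[OF that] that ps(2) by (auto simp: nth_eq_iff_index_eq k_def)
  \<comment> \<open>\<open>move g\<close> is the action of \<open>g\<close> on points, and \<open>ret g j\<close> is the element of \<open>H\<close> that corrects the
      representative when \<open>g\<close> moves the point \<open>j\<close>; it is a cocycle over that action.\<close>
  define move where "move g j = \<tau> (t j \<otimes>\<^bsub>G\<^esub> inv\<^bsub>G\<^esub> g)" for g j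
  define ret where "ret g j = t (move g j) \<otimes>\<^bsub>G\<^esub> (g \<otimes>\<^bsub>G\<^esub> inv\<^bsub>G\<^esub> t j)" for g j
  have move: "move g j < k" "H #>\<^bsub>G\<^esub> t (move g j) = H #>\<^bsub>G\<^esub> (t j \<otimes>\<^bsub>G\<^esub> inv\<^bsub>G\<^esub> g)"
    if "g \<in> carrier G" "j < k" for g j
    using that \<tau>[of "t j \<otimes>\<^bsub>G\<^esub> inv\<^bsub>G\<^esub> g"] t by (auto simp: move_def)
  have ret_H: "ret g j \<in> H" if "g \<in> carrier G" "j < k" for g j
  proof -
    have "t (move g j) \<in> H #>\<^bsub>G\<^esub> (t j \<otimes>\<^bsub>G\<^esub> inv\<^bsub>G\<^esub> g)"
      using G.rcos_self[OF _ H(1), of "t (move g j)"] move[OF that] t that by simp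
    then have "t (move g j) \<otimes>\<^bsub>G\<^esub> inv\<^bsub>G\<^esub> (t j \<otimes>\<^bsub>G\<^esub> inv\<^bsub>G\<^esub> g) \<in> H"
      using move[OF that] t that by (subst (asm) subgroup.rcos_module[OF H(1) G.is_group]) auto
    then show ?thesis using t that by (simp add: ret_def G.inv_mult_group)
  qed
  have move_mult: "move (g \<otimes>\<^bsub>G\<^esub> g') j = move g (move g' j)"
    if "g \<in> carrier G" "g' \<in> carrier G" "j < k" for g g' j
  proof -
    have "H #>\<^bsub>G\<^esub> (t (move g' j) \<otimes>\<^bsub>G\<^esub> inv\<^bsub>G\<^esub> g) = (H #>\<^bsub>G\<^esub> t (move g' j)) #>\<^bsub>G\<^esub> inv\<^bsub>G\<^esub> g"
      using that t(1)[OF move(1)] by (intro G.coset_mult_assoc[symmetric] H_carrier) auto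
    also have "\<dots> = H #>\<^bsub>G\<^esub> (t j \<otimes>\<^bsub>G\<^esub> inv\<^bsub>G\<^esub> g' \<otimes>\<^bsub>G\<^esub> inv\<^bsub>G\<^esub> g)"
      unfolding move(2)[OF that(2,3)] using that t(1) by (intro G.coset_mult_assoc H_carrier) auto
    also have "t j \<otimes>\<^bsub>G\<^esub> inv\<^bsub>G\<^esub> g' \<otimes>\<^bsub>G\<^esub> inv\<^bsub>G\<^esub> g = t j \<otimes>\<^bsub>G\<^esub> inv\<^bsub>G\<^esub> (g \<otimes>\<^bsub>G\<^esub> g')"
      using that t(1) by (simp add: G.inv_mult_group)
    finally show ?thesis unfolding move_def by (intro \<tau>_cong[symmetric])
  qed
  have ret_mult: "ret (g \<otimes>\<^bsub>G\<^esub> g') j = ret g (move g' j) \<otimes>\<^bsub>G\<^esub> ret g' j"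
    if "g \<in> carrier G" "g' \<in> carrier G" "j < k" for g g' j
  proof -
    have "inv\<^bsub>G\<^esub> t (move g' j) \<otimes>\<^bsub>G\<^esub> (t (move g' j) \<otimes>\<^bsub>G\<^esub> x) = x" if "x \<in> carrier G" for x
      using that \<open>g' \<in> carrier G\<close> \<open>j < k\<close> move t by (simp add: G.m_assoc[symmetric] del: G.m_assoc)
    then show ?thesis
      using that move t by (simp add: ret_def move_mult)
  qed
  have move_one: "move \<one>\<^bsub>G\<^esub> j = j" and ret_one: "ret \<one>\<^bsub>G\<^esub> j = \<one>\<^bsub>G\<^esub>" if "j < k" for j
    using that t \<tau>_t by (simp_all add: move_def ret_def)

  \<comment> \<open>A table can only record the letters of the presentation; it defines the same action of words
      in those letters as \<open>\<delta>\<close>.\<close>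
  define \<delta> where "\<delta> l j = (move (cls [l]) j, h (ret (cls [l]) j))" for l j
  have "finite (({..<n} \<times> UNIV) \<times> {..<k} :: (nat letter \<times> nat) set)" by simp
  from lookup_table[OF this] obtain T
    where "\<forall>l j. (l, j) \<in> ({..<n} \<times> UNIV) \<times> {..<k} \<longrightarrow> lookup T l j = \<delta> l j"
    by blast
  then have T: "lookup T l j = \<delta> l j" if "fst l < n" "j < k" for l j
    using that by (cases l) simp
  have act_eq: "act (lookup T) w (j, []) = (move (cls w) j, h (ret (cls w) j))"
    if "w \<in> W" "j < k" for w j
    using that(1)
  proof (induction w)
    case Nil
    show ?case using that(2) by (simp add: act_Nil cls_Nil move_one ret_one h_one)
  next
    case (Cons l w)
    then have lw: "[l] \<in> W" "w \<in> W" "fst l < n" by (auto simp: words_over_simps)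
    then have mw: "move (cls w) j < k" using move that(2) by auto
    have "h (ret (cls w) j) \<in> carrier (free_group S)"
      using lw that(2) by (intro h_carrier ret_H) auto
    then have red: "reduced (h (ret (cls w) j))" by (simp add: mem_carrier_free_group)
    have "cls (l # w) = cls [l] \<otimes>\<^bsub>G\<^esub> cls w" using cls_append[OF lw(1,2)] by simp
    then have "move (cls (l # w)) j = move (cls [l]) (move (cls w) j)"
      "h (ret (cls (l # w)) j) = free_reduce (h (ret (cls [l]) (move (cls w) j)) @ h (ret (cls w) j))"
      using lw that(2) mw by (simp_all add: move_mult ret_mult h_mult ret_H)
    then show ?case
      using Cons.IH lw mw red by (simp add: act_Cons T \<delta>_def foldr_push_letter_reduced)
  qed
  have trivial: "act (lookup T) w (j, []) = (j, [])" if "w \<in> W" "cls w = \<one>\<^bsub>G\<^esub>" "j < k" for w j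
    using that by (simp add: act_eq move_one ret_one h_one)
  have loop: "\<exists>u\<in>W. act (lookup T) u (0, []) = (0, [(s, True)])" if "s \<in> S" for s
  proof -
    have "[(s, True)] \<in> carrier (free_group S)" using that by (simp add: mem_carrier_free_group words_over_simps)
    then have "[(s, True)] \<in> h ` H" using h by (simp add: epi_def)
    then obtain C where C: "C \<in> H" "h C = [(s, True)]" by (elim imageE) simp
    then obtain u where u: "u \<in> W" "cls u = C" using cls_surj H_carrier by blast
    have "H #>\<^bsub>G\<^esub> inv\<^bsub>G\<^esub> C = H #>\<^bsub>G\<^esub> t 0"
      using C(1) H_carrier H(1)
      by (simp add: t0 G.coset_mult_one G.coset_join2 subgroup.m_inv_closed subsetD)
    then have "\<tau> (inv\<^bsub>G\<^esub> C) = 0"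
      using \<tau>_cong \<tau>_t[OF k] by metis
    then have "move C 0 = 0"
      using C(1) H_carrier by (simp add: move_def t0 subsetD)
    then have "act (lookup T) u (0, []) = (0, [(s, True)])"
      using u C H_carrier k by (simp add: act_eq ret_def t0 subsetD)
    with u show ?thesis by blast
  qed
  obtain u v where uv: "u \<in> W" "act (lookup T) u (0, []) = (0, [(a, True)])"
    "v \<in> W" "act (lookup T) v (0, []) = (0, [(b, True)])"
    using loop ab by meson
  have "fst (lookup T (i, c) j) < k" if "i < n" "j < k" for i j c
    using that by (simp add: T \<delta>_def move words_over_simps)
  moreover have "act (lookup T) [(i, c), (i, \<not> c)] (j, []) = (j, [])" if "i < n" "j < k" for i j c
    using that by (intro trivial cls_cancel) (auto simp: words_over_simps)
  moreover have "act (lookup T) r (j, []) = (j, [])" if "r \<in> set rs" "j < k" for r j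
    using that presentation by (intro trivial cls_relator) (auto simp: is_presentation_def)
  ultimately have "certifies_large n rs k (lookup T) a b u v"
    using uv ab k by (simp add: certifies_large_def words_over_lessThan list_all_iff[of _ rs])
  then have "checks (n, rs) (k, T, (a, b), u, v)" by simp
  then show ?thesis by blast
qed

end

section \<open>Largeness is semidecidable\<close>

theorem theorem2p6:
  shows "\<exists>A. \<forall>n rs. is_presentation n rs \<longrightarrow>
           (answers_yes A (encode_presentation n rs) \<longleftrightarrow> large (presented_group n rs))"
proof -
  have "(\<exists>c. checks (n, rs) c) \<longleftrightarrow> large (presented_group n rs)" if "is_presentation n rs" for n rs
  proof
    assume "\<exists>c. checks (n, rs) c"
    then obtain k T a b u v where "checks (n, rs) (k, T, (a, b), u, v)" by (metis surj_pair)
    with that show "large (presented_group n rs)" by (auto intro: large_if_certified)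
  next
    assume "large (presented_group n rs)"
    with that show "\<exists>c. checks (n, rs) c"
      by (intro presentation.certified_if_large) (simp_all add: presentation_def)
  qed
  then show ?thesis using semidecidable_checks by metis
qed

end
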